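(* Let $q$ and $q+2$ both be prime powers, and consider the commutative association scheme on $X=\mathbb{F}_{q+2}\times\mathbb{F}_q\times\mathbb{F}_q$ with adjacency matrices $A_0=I_{(q+2)q^2}$ (relation $R_0$), $A_1=(J_{q+2}-I_{q+2})\otimes I_{q^2}$ (relation $R_1$), $A_2=I_{q+2}\otimes(J_{q^2}-I_{q^2})$ (relation $R_2$), and $A_{3,\beta}=N_\beta-A_1$ (relation $R_{3,\beta}$) for $\beta\in\mathbb{F}_{q+2}^*$, with $N_\beta$ as in the context. Define the following subspaces of $\mathbb{C}^X$ spanned by characters $\chi_{\beta',\alpha_1',\alpha_2'}$ (see context): $V_0=\mathrm{span}\{\chi_{0,0,0}\}$; $V_1=\mathrm{span}\{\chi_{\beta,0,0}:\beta\in\mathbb{F}_{q+2}^*\}$; $V_2=\mathrm{span}\{\chi_{0,\alpha_1,\alpha_2}:\alpha_1,\alpha_2\in\mathbb{F}_q,(\alpha_1,\alpha_2)\neq(0,0)\}$; and for $\tilde\beta\in\mathbb{F}_{q+2}^*$, $V_{3,\tilde\beta}$ is the span of all $\chi_{\beta',\alpha_1',\alpha_2'}$ with $\beta'\in\mathbb{F}_{q+2}^*$, $\alpha_1'\in\mathbb{F}_q$, $\alpha_2'\in\mathbb{F}_q^*$, $\beta'\varphi^{-1}(-\alpha_1'/\alpha_2')=\tilde\beta$, together with all $\chi_{\beta',\alpha_1',0}$ with $\beta'\in\mathbb{F}_{q+2}^*$, $\alpha_1'\in\mathbb{F}_q^*$, $\beta'\varphi^{-1}(y)=\tilde\beta$.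 Then $V_0,V_1,V_2,V_{3,\tilde\beta}$ ($\tilde\beta\in\mathbb{F}_{q+2}^*$) are the maximal common eigenspaces of the adjacency matrices (the images of the primitive idempotents), and the first eigenmatrix $P$, whose entry in row $V$ and column $R$ is the eigenvalue of the adjacency matrix of $R$ on $V$, is given by: row $V_0$: $R_0\mapsto1$, $R_1\mapsto q+1$, $R_2\mapsto q^2-1$, $R_{3,\beta}\mapsto q^2-1$; row $V_1$: $R_0\mapsto1$, $R_1\mapsto -1$, $R_2\mapsto q^2-1$, $R_{3,\beta}\mapsto -q+1$; row $V_2$: $R_0\mapsto1$, $R_1\mapsto q+1$, $R_2\mapsto -1$, $R_{3,\beta}\mapsto -1$; row $V_{3,\tilde\beta}$: $R_0\mapsto1$, $R_1\mapsto -1$, $R_2\mapsto -1$, $R_{3,\beta}\mapsto q\,\chi_{q+2}(\tilde\beta/\beta)+1$; for all $\beta,\tilde\beta\in\mathbb{F}_{q+2}^*$.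
   Context: $I_n,J_n$ are the identity and all-ones matrices of order $n$, $\mathbb{F}_r^*=\mathbb{F}_r\setminus\{0\}$, $\otimes$ is the Kronecker product. Let $x,y$ be two new symbols and fix a bijection $\varphi:\mathbb{F}_{q+2}\to\mathbb{F}_q\cup\{x,y\}$ with $\varphi(0)=x$. Matrices of order $(q+2)q^2$ have rows and columns indexed by $X$ (lexicographic order, compatible with the Kronecker products). For $\beta\in\mathbb{F}_{q+2}^*$, $N_\beta$ is the $(0,1)$-matrix whose $((b,a_1,a_2),(b',a_1',a_2'))$-entry is: with $c=\varphi(\beta(b'-b))$, the entry is $1$ if $c\in\mathbb{F}_q$ and $a_2'-a_2=c(a_1'-a_1)$, or if $c=y$ and $a_1=a_1'$; and $0$ otherwise. For a prime power $r=p^m$ ($p$ prime), the canonical additive character of $\mathbb{F}_r$ is $\chi_r(a)=\exp(2\pi i\,\mathrm{Tr}(a)/p)$ where $\mathrm{Tr}:\mathbb{F}_r\to\mathbb{F}_p$ is the absolute trace. For $\beta'\in\mathbb{F}_{q+2}$, $\alpha_1',\alpha_2'\in\mathbb{F}_q$, the character $\chi_{\beta',\alpha_1',\alpha_2'}$ of $X$ is $\chi_{\beta',\alpha_1',\alpha_2'}(\beta,\alpha_1,\alpha_2)=\chi_{q+2}(\beta'\beta)\chi_q(\alpha_1'\alpha_1+\alpha_2'\alpha_2)$, viewed as a vector in $\mathbb{C}^X$. *)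

theory Defs
  imports "HOL-Analysis.Analysis" "HOL-Computational_Algebra.Primes"
begin

section \<open>Canonical additive characters of finite fields\<close>

definition degree_over_prime_field :: "'a::finite_field itself \<Rightarrow> nat" where
  "degree_over_prime_field _ = (THE m. CARD('a) = CHAR('a) ^ m)"

definition absolute_trace :: "'a::finite_field \<Rightarrow> 'a" where
  "absolute_trace a = (\<Sum>i<degree_over_prime_field TYPE('a). a ^ (CHAR('a) ^ i))"

text \<open>The absolute trace takes values in the prime subfield \<open>{of_nat n | n. n < p}\<close>.  In the exponential
  it is read as an integer modulo \<open>p\<close>, for which we take the representative \<open>n < p\<close>.\<close>

definition prime_field_rep :: "'a::finite_field \<Rightarrow> nat" where
  "prime_field_rep a = (THE n. n < CHAR('a) \<and> of_nat n = a)"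

definition canonical_char :: "'a::finite_field \<Rightarrow> complex" where
  "canonical_char a =
     exp (2 * of_real pi * \<i> * of_nat (prime_field_rep (absolute_trace a)) / of_nat CHAR('a))"


section \<open>Commutative association schemes and their eigenspaces\<close>

definition all_ones :: "complex^'n^'n" where
  "all_ones = (\<chi> i j. 1)"

definition kronecker :: "complex^'n^'n \<Rightarrow> complex^'m^'m \<Rightarrow> complex^('n \<times> 'm)^('n \<times> 'm)"
    (infixr "\<otimes>\<^sub>K" 72) where
  "A \<otimes>\<^sub>K B = (\<chi> i j. A $ fst i $ fst j * B $ snd i $ snd j)"

text \<open>A family of matrices \<open>A\<close> is given on a finite set \<open>I\<close> of labels, \<open>i0\<close> labelling the identity;
  \<open>p i j k\<close> are the intersection numbers.\<close>

definition commutative_association_scheme ::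
    "'i \<Rightarrow> 'i set \<Rightarrow> ('i \<Rightarrow> complex^'x^'x) \<Rightarrow> bool" where
  "commutative_association_scheme i0 I A \<longleftrightarrow>
     finite I \<and> i0 \<in> I \<and>
     (\<forall>i\<in>I. A i \<noteq> 0 \<and> (\<forall>x y. A i $ x $ y \<in> {0, 1})) \<and>
     A i0 = mat 1 \<and>
     (\<Sum>i\<in>I. A i) = all_ones \<and>
     (\<forall>i\<in>I. \<exists>j\<in>I. transpose (A i) = A j) \<and>
     (\<exists>p :: 'i \<Rightarrow> 'i \<Rightarrow> 'i \<Rightarrow> nat. \<forall>i\<in>I. \<forall>j\<in>I. A i ** A j = (\<Sum>k\<in>I. of_nat (p i j k) *\<^sub>R A k)) \<and>
     (\<forall>i\<in>I. \<forall>j\<in>I. A i ** A j = A j ** A i)"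

text \<open>The complex linear span of the adjacency matrices (\<open>mat c ** M\<close> is \<open>M\<close> scaled by \<open>c\<close>).\<close>

definition bose_mesner_algebra :: "'i set \<Rightarrow> ('i \<Rightarrow> complex^'x^'x) \<Rightarrow> (complex^'x^'x) set" where
  "bose_mesner_algebra I A = {\<Sum>i\<in>I. mat (c i) ** A i | c. True}"

definition primitive_idempotent :: "(complex^'x^'x) set \<Rightarrow> complex^'x^'x \<Rightarrow> bool" where
  "primitive_idempotent \<A> E \<longleftrightarrow>
     E \<in> \<A> \<and> E \<noteq> 0 \<and> E ** E = E \<and>
     \<not> (\<exists>F\<in>\<A>. \<exists>G\<in>\<A>. F \<noteq> 0 \<and> G \<noteq> 0 \<and> F ** F = F \<and> G ** G = G \<and>
          F ** G = 0 \<and> G ** F = 0 \<and> E = F + G)"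

definition common_eigenspace ::
    "'i set \<Rightarrow> ('i \<Rightarrow> complex^'x^'x) \<Rightarrow> (complex^'x) set \<Rightarrow> bool" where
  "common_eigenspace I A U \<longleftrightarrow>
     vec.subspace U \<and> U \<noteq> {0} \<and> (\<forall>i\<in>I. \<exists>\<theta>. \<forall>v\<in>U. A i *v v = \<theta> *s v)"

definition maximal_common_eigenspace ::
    "'i set \<Rightarrow> ('i \<Rightarrow> complex^'x^'x) \<Rightarrow> (complex^'x) set \<Rightarrow> bool" where
  "maximal_common_eigenspace I A U \<longleftrightarrow>
     common_eigenspace I A U \<and> (\<forall>W. common_eigenspace I A W \<and> U \<subseteq> W \<longrightarrow> W = U)"

text \<open>\<open>V\<close> enumerates, over the labels \<open>J\<close>, the images of the primitive idempotents.  These are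
  nonzero, so the values \<open>P j i\<close> with \<open>j \<in> J\<close> and \<open>i \<in> I\<close> are uniquely determined.\<close>

definition first_eigenmatrix ::
    "'i set \<Rightarrow> ('i \<Rightarrow> complex^'x^'x) \<Rightarrow> 'j set \<Rightarrow> ('j \<Rightarrow> (complex^'x) set) \<Rightarrow>
     ('j \<Rightarrow> 'i \<Rightarrow> complex) \<Rightarrow> bool" where
  "first_eigenmatrix I A J V P \<longleftrightarrow>
     bij_betw V J {range (\<lambda>v. E *v v) | E. primitive_idempotent (bose_mesner_algebra I A) E} \<and>
     (\<forall>j\<in>J. \<forall>i\<in>I. \<forall>v\<in>V j. A i *v v = P j i *s v)"


section \<open>The scheme on \<open>\<F>\<^sub>q\<^sub>+\<^sub>2 \<times> \<F>\<^sub>q \<times> \<F>\<^sub>q\<close>\<close>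

text \<open>Throughout, the type \<open>'f\<close> is the field with \<open>q\<close> elements and \<open>'g\<close> the field with \<open>q + 2\<close>
  elements; \<open>'f ext\<close> is \<open>'f\<close> together with the two new symbols.\<close>

datatype 'f ext = Elem 'f | SymX | SymY

text \<open>The indices \<open>\<beta>\<close> below range over nonzero field elements only, see \<open>rel_labels\<close> and \<open>eig_labels\<close>.\<close>

datatype 'g rel_label = R0 | R1 | R2 | R3 'g

datatype 'g eig_label = V0 | V1 | V2 | V3 'g

definition rel_labels :: "'g::finite_field rel_label set" where
  "rel_labels = {R0, R1, R2} \<union> {R3 \<beta> | \<beta>. \<beta> \<noteq> 0}"

definition eig_labels :: "'g::finite_field eig_label set" where
  "eig_labels = {V0, V1, V2} \<union> {V3 \<beta> | \<beta>. \<beta> \<noteq> 0}"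

definition N_mat :: "('g::finite_field \<Rightarrow> 'f::finite_field ext) \<Rightarrow> 'g \<Rightarrow>
    complex^('g \<times> 'f \<times> 'f)^('g \<times> 'f \<times> 'f)" where
  "N_mat \<phi> \<beta> = (\<chi> s t. case s of (b, a1, a2) \<Rightarrow> case t of (b', a1', a2') \<Rightarrow>
     (case \<phi> (\<beta> * (b' - b)) of
        Elem c \<Rightarrow> if a2' - a2 = c * (a1' - a1) then 1 else 0
      | SymY \<Rightarrow> if a1 = a1' then 1 else 0
      | SymX \<Rightarrow> 0))"

fun adjacency :: "('g::finite_field \<Rightarrow> 'f::finite_field ext) \<Rightarrow> 'g rel_label \<Rightarrow>
    complex^('g \<times> 'f \<times> 'f)^('g \<times> 'f \<times> 'f)" where
  "adjacency \<phi> R0 = mat 1"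
| "adjacency \<phi> R1 = (all_ones - mat 1) \<otimes>\<^sub>K mat 1"
| "adjacency \<phi> R2 = mat 1 \<otimes>\<^sub>K (all_ones - mat 1)"
| "adjacency \<phi> (R3 \<beta>) = N_mat \<phi> \<beta> - (all_ones - mat 1) \<otimes>\<^sub>K mat 1"

definition char_vec :: "'g::finite_field \<Rightarrow> 'f::finite_field \<Rightarrow> 'f \<Rightarrow> complex^('g \<times> 'f \<times> 'f)" where
  "char_vec \<beta>' \<alpha>1' \<alpha>2' = (\<chi> s. case s of (\<beta>, \<alpha>1, \<alpha>2) \<Rightarrow>
     canonical_char (\<beta>' * \<beta>) * canonical_char (\<alpha>1' * \<alpha>1 + \<alpha>2' * \<alpha>2))"

fun eigspace :: "('g::finite_field \<Rightarrow> 'f::finite_field ext) \<Rightarrow> 'g eig_label \<Rightarrow>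
    (complex^('g \<times> 'f \<times> 'f)) set" where
  "eigspace \<phi> V0 = vec.span {char_vec 0 0 0}"
| "eigspace \<phi> V1 = vec.span {char_vec \<beta> 0 0 | \<beta>. \<beta> \<noteq> 0}"
| "eigspace \<phi> V2 = vec.span {char_vec 0 \<alpha>1 \<alpha>2 | \<alpha>1 \<alpha>2. (\<alpha>1, \<alpha>2) \<noteq> (0, 0)}"
| "eigspace \<phi> (V3 \<gamma>) = vec.span (
     {char_vec \<beta>' \<alpha>1' \<alpha>2' | \<beta>' \<alpha>1' \<alpha>2'.
        \<beta>' \<noteq> 0 \<and> \<alpha>2' \<noteq> 0 \<and> \<beta>' * inv \<phi> (Elem (- \<alpha>1' / \<alpha>2')) = \<gamma>} \<union>
     {char_vec \<beta>' \<alpha>1' 0 | \<beta>' \<alpha>1'. \<beta>' \<noteq> 0 \<and> \<alpha>1' \<noteq> 0 \<and> \<beta>' * inv \<phi> SymY = \<gamma>})"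

end

theory Submission
  imports Defs "HOL-Number_Theory.Cong"
begin

text \<open>All adjacency matrices are invariant under translation, so every character of \<open>X\<close> is a common
  eigenvector, with eigenvalue the sum of the character over the differences lying in the relation.
  For \<open>N\<^sub>\<beta>\<close> this sum collapses: a nontrivial character \<open>(\<alpha>\<^sub>1', \<alpha>\<^sub>2')\<close> of the plane sums to zero over
  every line through the origin except the single one on which it is trivial.

  The rows of the resulting matrix \<open>P\<close> are then orthogonal with respect to the multiplicities and
  valencies, so \<open>P\<close> has an explicit inverse.  Hence the projections onto the character spans are
  linear combinations of the adjacency matrices, and the span of the latter is exactly the algebra of
  matrices acting as a scalar on each \<open>V\<^sub>j\<close>.  Closure under multiplication, commutativity, the primitive
  idempotents and the maximal common eigenspaces are all read off from this description.\<close>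

section \<open>Finite fields\<close>

lemma additive_subset_of_nat_mult:
  fixes S :: "'a::ring_1 set"
  assumes "0 \<in> S" and "\<And>u v. u \<in> S \<Longrightarrow> v \<in> S \<Longrightarrow> u + v \<in> S" and "u \<in> S"
  shows "of_nat n * u \<in> S"
  using assms by (induction n) (auto simp: algebra_simps)

text \<open>Adjoining the multiples of \<open>x\<close> to an additive subgroup gives a direct sum:
  a nonzero multiple \<open>of_nat k * x\<close> inside \<open>S\<close> could be divided by
  \<open>k\<close> modulo the characteristic, which would put \<open>x\<close> itself into
  \<open>S\<close>.\<close>

lemma additive_subset_extend:
  fixes S :: "'a::finite_field set"
  assumes zero: "0 \<in> S" and add: "\<And>u v. u \<in> S \<Longrightarrow> v \<in> S \<Longrightarrow> u + v \<in> S" and x: "x \<notin> S"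
  defines "T \<equiv> (\<lambda>(n, s). of_nat n * x + s) ` ({..<CHAR('a)} \<times> S)"
  shows "0 \<in> T" and "\<And>u v. u \<in> T \<Longrightarrow> v \<in> T \<Longrightarrow> u + v \<in> T" and "card T = CHAR('a) * card S"
proof -
  let ?p = "CHAR('a)"
  note closed = additive_subset_of_nat_mult[OF zero add]
  show "0 \<in> T"
    using zero unfolding T_def by (intro image_eqI[of _ _ "(0, 0)"]) auto
  show "u + v \<in> T" if uv: "u \<in> T" "v \<in> T" for u v
  proof -
    obtain n s m t where 1: "s \<in> S" "t \<in> S" "u = of_nat n * x + s" "v = of_nat m * x + t"
      using uv by (auto simp: T_def)
    have "(of_nat ((n + m) mod ?p) :: 'a) = of_nat (n + m)"
      unfolding of_nat_eq_iff_cong_CHAR by (simp add: cong_def)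
    hence "u + v = of_nat ((n + m) mod ?p) * x + (s + t)"
      using 1 by (simp add: algebra_simps)
    thus ?thesis
      using 1 add unfolding T_def by (intro image_eqI[of _ _ "((n + m) mod ?p, s + t)"]) auto
  qed
  \<comment> \<open>Closure under addition already gives negatives, because \<open>- s\<close> is
    the multiple of \<open>s\<close> by \<open>CHAR('a) - 1\<close>.\<close>
  have neg: "- s \<in> S" if "s \<in> S" for s
  proof -
    have "of_nat (?p - 1) * s = - s"
      by (simp add: of_nat_diff Suc_leI)
    moreover have "of_nat (?p - 1) * s \<in> S" using closed that by blast
    ultimately show ?thesis by simp
  qed
  \<comment> \<open>Injectivity, with the two coefficients ordered so that \<open>m - n\<close> is a
    natural number.\<close>
  have aux: "n = m \<and> s = t"
    if st: "s \<in> S" "t \<in> S" "n \<le> m" "m < ?p" "of_nat n * x + s = of_nat m * x + t" for n m s t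
  proof (cases "n = m")
    case False
    hence "0 < m - n" "m - n < ?p" using st by auto
    hence "\<not> ?p dvd (m - n)" by (auto dest: dvd_imp_le)
    hence "coprime ?p (m - n)"
      by (rule prime_imp_coprime[OF CHAR_prime])
    hence "coprime (m - n) ?p"
      by (rule coprime_commute[THEN iffD1])
    then obtain k where "[(m - n) * k = 1] (mod ?p)"
      using cong_solve_coprime_nat by auto
    hence k: "of_nat (m - n) * of_nat k = (1 :: 'a)"
      by (metis of_nat_1 of_nat_eq_iff_cong_CHAR of_nat_mult)
    have "of_nat (m - n) * x = s + - t"
      using st by (simp add: of_nat_diff algebra_simps)
    hence "of_nat k * (s + - t) = (of_nat (m - n) * of_nat k) * x"
      by (simp add: mult_ac)
    hence "of_nat k * (s + - t) = x"
      by (simp only: k mult_1_left)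
    moreover have "of_nat k * (s + - t) \<in> S"
      using closed add[OF st(1) neg[OF st(2)]] by blast
    ultimately show ?thesis using x by simp
  qed (use st in auto)
  have "inj_on (\<lambda>(n, s). of_nat n * x + s) ({..<?p} \<times> S)"
  proof (rule inj_onI, clarify)
    fix n m s t
    assume "n < ?p" "m < ?p" "s \<in> S" "t \<in> S" "of_nat n * x + s = of_nat m * x + t"
    thus "n = m \<and> s = t"
      using aux[of s t n m] aux[of t s m n] by (cases "n \<le> m") auto
  qed
  thus "card T = ?p * card S"
    unfolding T_def by (simp add: card_image card_cartesian_product)
qed

text \<open>Among the additive subsets whose size is a power of the characteristic, one of maximal
  size must be the whole field, since a proper one could be extended by a further element. The
  exponent is positive because 0 and 1 differ.\<close>

lemma card_finite_field:
  obtains m where "CARD('a::finite_field) = CHAR('a) ^ m" and "m > 0"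
proof -
  define good where "good = (\<lambda>S :: 'a set. 0 \<in> S \<and> (\<forall>u\<in>S. \<forall>v\<in>S. u + v \<in> S) \<and>
    (\<exists>m. card S = CHAR('a) ^ m))"
  have "good {0}"
    by (auto simp: good_def intro: exI[of _ 0])
  hence "\<exists>S. good S \<and> (\<forall>T. good T \<longrightarrow> card T \<le> card S)"
    by (intro ex_has_greatest_nat[of good "{0}" card "CARD('a) + 1"])
      (auto simp: less_Suc_eq_le card_mono)
  then obtain S where S: "good S" and max: "\<And>T. good T \<Longrightarrow> card T \<le> card S"
    by blast
  have "S = UNIV"
  proof (rule ccontr)
    assume "S \<noteq> UNIV"
    then obtain x where x: "x \<notin> S" by blast
    obtain m where m: "card S = CHAR('a) ^ m" using S by (auto simp: good_def)
    note ext = additive_subset_extend[OF _ _ x]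
    define T where "T = (\<lambda>(n, s). of_nat n * x + s) ` ({..<CHAR('a)} \<times> S)"
    have S': "0 \<in> S" "\<And>u v. u \<in> S \<Longrightarrow> v \<in> S \<Longrightarrow> u + v \<in> S"
      using S by (auto simp: good_def)
    have "good T" and "card T = CHAR('a) * card S"
      using ext[OF S'] m unfolding T_def good_def by (auto intro: exI[of _ "Suc m"])
    moreover have "card S > 0"
      using S'(1) by (auto simp: card_gt_0_iff)
    moreover have "CHAR('a) > 1"
      using CHAR_prime prime_gt_1_nat by blast
    ultimately show False
      using max[of T] by (simp add: not_le)
  qed
  then obtain m where m: "CARD('a) = CHAR('a) ^ m" using S by (auto simp: good_def)
  moreover have "m \<noteq> 0"
  proof
    assume "m = 0"
    hence "CARD('a) = 1" using m by simp
    then obtain z :: 'a where "UNIV = {z}" by (auto simp: card_1_singleton_iff)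
    hence "(0 :: 'a) = 1" by (metis UNIV_I singletonD)
    thus False by simp
  qed
  ultimately show thesis using that by auto
qed

lemma card_finite_field_degree:
  "CARD('a::finite_field) = CHAR('a) ^ degree_over_prime_field TYPE('a)"
proof -
  obtain m where m: "CARD('a) = CHAR('a) ^ m" using card_finite_field by blast
  have "CHAR('a) > 1" using CHAR_prime prime_gt_1_nat by blast
  hence "(THE m. CARD('a) = CHAR('a) ^ m) = m"
    using m by (intro the_equality) auto
  thus ?thesis using m by (simp add: degree_over_prime_field_def)
qed

lemma degree_over_prime_field_pos: "degree_over_prime_field TYPE('a::finite_field) > 0"
proof -
  obtain m where "CARD('a) = CHAR('a) ^ m" "m > 0" using card_finite_field by blast
  moreover have "CHAR('a) > 1" using CHAR_prime prime_gt_1_nat by blast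
  ultimately show ?thesis
    using card_finite_field_degree[where 'a = 'a] by (metis not_gr0 power_inject_exp)
qed

section \<open>The Frobenius map and the absolute trace\<close>

lemma frobenius_add:
  fixes x y :: "'a::finite_field"
  shows "(x + y) ^ CHAR('a) = x ^ CHAR('a) + y ^ CHAR('a)"
proof -
  let ?p = "CHAR('a)"
  have p: "?p > 0" by simp
  have "(x + y) ^ ?p = (\<Sum>k\<le>?p. of_nat (?p choose k) * x ^ k * y ^ (?p - k))"
    by (rule binomial_ring)
  also have "\<dots> = (\<Sum>k\<in>{0, ?p}. of_nat (?p choose k) * x ^ k * y ^ (?p - k))"
  proof (rule sum.mono_neutral_right)
    show "\<forall>i\<in>{..?p} - {0, ?p}. of_nat (?p choose i) * x ^ i * y ^ (?p - i) = 0"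
    proof
      fix i assume "i \<in> {..?p} - {0, ?p}"
      hence "?p dvd (?p choose i)" by (intro dvd_choose_prime) auto
      hence "of_nat (?p choose i) = (0 :: 'a)" by (simp only: of_nat_eq_0_iff_char_dvd)
      thus "of_nat (?p choose i) * x ^ i * y ^ (?p - i) = 0" by simp
    qed
  qed auto
  also have "\<dots> = x ^ ?p + y ^ ?p" using p by (simp add: add.commute)
  finally show ?thesis .
qed

lemma frobenius_power_add:
  fixes x y :: "'a::finite_field"
  shows "(x + y) ^ (CHAR('a) ^ i) = x ^ (CHAR('a) ^ i) + y ^ (CHAR('a) ^ i)"
  by (induction i) (simp_all add: power_Suc2 power_mult frobenius_add del: power_Suc)

lemma frobenius_sum:
  fixes f :: "'b \<Rightarrow> 'a::finite_field"
  shows "finite A \<Longrightarrow> (\<Sum>i\<in>A. f i) ^ CHAR('a) = (\<Sum>i\<in>A. f i ^ CHAR('a))"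
  by (induction A rule: finite_induct) (simp_all add: frobenius_add power_0_left)

lemma absolute_trace_add: "absolute_trace (a + b) = absolute_trace a + absolute_trace b"
  by (simp add: absolute_trace_def frobenius_power_add sum.distrib)

text \<open>The Frobenius map shifts the summands \<open>a ^ (p ^ i)\<close> by one place, and the
  last wraps around to the first because \<open>a ^ CARD('a) = a\<close>. Hence the trace lies in
  the fixed field of Frobenius.\<close>

lemma absolute_trace_frobenius:
  fixes a :: "'a::finite_field"
  shows "absolute_trace a ^ CHAR('a) = absolute_trace a"
proof -
  define m where "m = degree_over_prime_field TYPE('a)"
  let ?f = "\<lambda>i. a ^ (CHAR('a) ^ i)"
  have "absolute_trace a ^ CHAR('a) = (\<Sum>i<m. ?f (Suc i))"
    unfolding absolute_trace_def m_def
    by (simp add: frobenius_sum power_mult[symmetric] mult.commute)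
  moreover have "?f 0 + (\<Sum>i<m. ?f (Suc i)) = (\<Sum>i<m. ?f i) + ?f m"
    using sum.lessThan_Suc[of ?f m] sum.lessThan_Suc_shift[of ?f m] by simp
  moreover have "?f m = ?f 0"
    using finite_field_power_card_eq_same[of a] card_finite_field_degree[where 'a = 'a]
    by (simp add: m_def)
  ultimately have "absolute_trace a ^ CHAR('a) = (\<Sum>i<m. ?f i)"
    by (simp add: add.commute)
  thus ?thesis by (simp add: absolute_trace_def m_def)
qed

text \<open>The polynomial \<open>X^p - X\<close> has at most \<open>p\<close> roots, and the
  residues below \<open>p\<close> are already that many. Together with the preceding lemma this
  makes \<open>prime_field_rep\<close> meaningful on traces.\<close>

lemma frobenius_fixed_imp_of_nat:
  fixes x :: "'a::finite_field"
  assumes "x ^ CHAR('a) = x"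
  shows "\<exists>n<CHAR('a). of_nat n = x"
proof -
  let ?p = "CHAR('a)"
  define f :: "'a poly" where "f = monom 1 ?p - monom 1 1"
  have p: "?p > 1" using CHAR_prime prime_gt_1_nat by blast
  have "coeff f ?p = 1" using p by (simp add: f_def)
  hence f: "f \<noteq> 0" by auto
  have "degree f \<le> ?p" using p
    unfolding f_def by (intro degree_diff_le) (auto intro: order.trans[OF degree_monom_le])
  hence card: "card {x. poly f x = 0} \<le> ?p"
    using card_poly_roots_bound[OF f] by simp
  have eval: "poly f x = x ^ ?p - x" for x by (simp add: f_def poly_monom)
  have fixed: "(of_nat n :: 'a) ^ ?p = of_nat n" for n
    by (induction n) (simp_all add: frobenius_add power_0_left)
  have "inj_on (of_nat :: nat \<Rightarrow> 'a) {..<?p}"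
    by (auto simp: inj_on_def of_nat_eq_iff_cong_CHAR cong_def)
  hence "card (of_nat ` {..<?p} :: 'a set) = ?p" by (simp add: card_image)
  moreover have "of_nat ` {..<?p} \<subseteq> {x. poly f x = 0}" by (auto simp: eval fixed)
  ultimately have "of_nat ` {..<?p} = {x. poly f x = 0}"
    using card by (intro card_seteq) auto
  moreover have "poly f x = 0" using assms by (simp add: eval)
  ultimately have "x \<in> of_nat ` {..<?p}" by blast
  thus ?thesis by auto
qed

text \<open>The trace is a polynomial function of degree at most \<open>p ^ (m - 1)\<close>, less
  than the size of the field. The polynomial is nonzero since its coefficient at \<open>X\<close> is
  1, so it cannot vanish everywhere.\<close>

lemma absolute_trace_nonzero: "\<exists>a :: 'a::finite_field. absolute_trace a \<noteq> 0"
proof (rule ccontr)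
  assume all: "\<not> ?thesis"
  define m where "m = degree_over_prime_field TYPE('a)"
  have m: "m > 0" by (simp add: m_def degree_over_prime_field_pos)
  have p: "CHAR('a) > 1" using CHAR_prime prime_gt_1_nat by blast
  define f :: "'a poly" where "f = (\<Sum>i<m. monom 1 (CHAR('a) ^ i))"
  have "coeff f 1 = (\<Sum>i<m. if i = 0 then 1 else 0)"
    unfolding f_def coeff_sum using p by (intro sum.cong) (auto simp: coeff_monom)
  also have "\<dots> = 1" using m by simp
  finally have f: "f \<noteq> 0" by auto
  have "degree f \<le> CHAR('a) ^ (m - 1)"
    unfolding f_def using m p
    by (intro degree_sum_le) (auto intro!: order.trans[OF degree_monom_le] power_increasing)
  also have "\<dots> < CHAR('a) ^ m" using m p by (intro power_strict_increasing) auto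
  also have "\<dots> = CARD('a)" by (simp add: m_def card_finite_field_degree)
  finally have "degree f < CARD('a)" .
  moreover have "poly f a = absolute_trace a" for a
    by (simp add: f_def poly_sum poly_monom absolute_trace_def m_def)
  hence "{x. poly f x = 0} = UNIV" using all by auto
  ultimately show False using card_poly_roots_bound[OF f] by simp
qed

section \<open>The canonical additive character\<close>

text \<open>The base is a \<open>p\<close>-th root of unity, so any natural number representing the
  trace may serve as exponent, not just the reduced one. This turns additivity of the trace into
  multiplicativity of the character.\<close>

lemma canonical_char_eq_power:
  fixes a :: "'a::finite_field"
  assumes "of_nat n = absolute_trace a"
  shows "canonical_char a = exp (2 * of_real pi * \<i> / of_nat CHAR('a)) ^ n"
proof -
  let ?p = "CHAR('a)"
  let ?w = "exp (2 * of_real pi * \<i> / of_nat ?p) :: complex"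
  have "prime_field_rep (absolute_trace a) = n mod ?p"
    unfolding prime_field_rep_def
  proof (rule the_equality)
    show "n mod ?p < ?p \<and> of_nat (n mod ?p) = absolute_trace a"
      using assms by (metis CHAR_pos cong_mod_left cong_refl mod_less_divisor of_nat_eq_iff_cong_CHAR)
    show "k = n mod ?p" if "k < ?p \<and> of_nat k = absolute_trace a" for k
      using that assms by (metis cong_def mod_less of_nat_eq_iff_cong_CHAR)
  qed
  hence "canonical_char a = ?w ^ (n mod ?p)"
    unfolding canonical_char_def by (simp add: exp_of_nat_mult[symmetric] mult_ac)
  moreover have "?w ^ ?p = 1"
    by (simp add: exp_of_nat_mult[symmetric])
  hence "?w ^ (?p * (n div ?p) + n mod ?p) = ?w ^ (n mod ?p)"
    by (simp only: power_add power_mult power_one mult_1_left)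
  ultimately show ?thesis by simp
qed

lemma canonical_char_add: "canonical_char (a + b) = canonical_char a * canonical_char b"
proof -
  obtain n m where "of_nat n = absolute_trace a" "of_nat m = absolute_trace b"
    using frobenius_fixed_imp_of_nat absolute_trace_frobenius by metis
  thus ?thesis
    using canonical_char_eq_power[of n a] canonical_char_eq_power[of m b]
      canonical_char_eq_power[of "n + m" "a + b"]
    by (simp add: absolute_trace_add power_add)
qed

lemma norm_canonical_char [simp]: "norm (canonical_char a) = 1"
  by (simp add: canonical_char_def)

lemma canonical_char_nonzero [simp]: "canonical_char a \<noteq> 0"
  by (simp add: canonical_char_def)

lemma canonical_char_0 [simp]: "canonical_char 0 = 1"
  using canonical_char_add[of 0 0] by simp

lemma cnj_canonical_char: "cnj (canonical_char a) = canonical_char (- a)"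
proof -
  have "canonical_char a * canonical_char (- a) = 1"
    using canonical_char_add[of a "- a"] by simp
  moreover have "canonical_char a * cnj (canonical_char a) = 1"
    by (simp add: complex_norm_square[symmetric])
  ultimately show ?thesis
    by (metis canonical_char_nonzero mult_left_cancel)
qed

lemma canonical_char_nontrivial: "\<exists>a :: 'a::finite_field. canonical_char a \<noteq> 1"
proof -
  obtain a :: 'a where a: "absolute_trace a \<noteq> 0" using absolute_trace_nonzero by blast
  obtain n where n: "n < CHAR('a)" "of_nat n = absolute_trace a"
    using frobenius_fixed_imp_of_nat absolute_trace_frobenius by metis
  hence n0: "n > 0" using a by (cases n) auto
  have "canonical_char a \<noteq> 1"
  proof
    assume "canonical_char a = 1"
    hence "exp (2 * of_real pi * \<i> * of_nat n / of_nat CHAR('a)) = (1 :: complex)"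
      using canonical_char_eq_power[OF n(2)] by (simp add: exp_of_nat_mult[symmetric] mult_ac)
    hence "CHAR('a) dvd n"
      using complex_root_unity_eq_1[of "CHAR('a)" n] CHAR_pos[where 'a = 'a] by linarith
    thus False using n n0 by (auto dest: dvd_imp_le)
  qed
  thus ?thesis by blast
qed

section \<open>Orthogonality of additive characters\<close>

lemma sum_canonical_char_mult:
  fixes b :: "'a::finite_field"
  shows "(\<Sum>x\<in>UNIV. canonical_char (b * x)) = (if b = 0 then of_nat CARD('a) else 0)"
proof (cases "b = 0")
  case False
  obtain a :: 'a where a: "canonical_char a \<noteq> 1" using canonical_char_nontrivial by blast
  let ?s = "\<Sum>x\<in>UNIV. canonical_char (b * x)"
  \<comment> \<open>Translating the summation variable by \<open>a / b\<close> multiplies the sum by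
    \<open>canonical_char a\<close>, which is not 1.\<close>
  have "?s = (\<Sum>x\<in>UNIV. canonical_char (b * (a / b + x)))"
    by (rule sum.reindex_bij_witness[of _ "\<lambda>x. a / b + x" "\<lambda>x. x - a / b"]) auto
  also have "\<dots> = canonical_char a * ?s"
    using False by (simp add: distrib_left canonical_char_add sum_distrib_left)
  finally have "(1 - canonical_char a) * ?s = 0" by (simp add: algebra_simps)
  thus ?thesis using a False by simp
qed simp

lemma sum_canonical_char_mult_nonzero:
  fixes b :: "'a::finite_field"
  shows "(\<Sum>x\<in>-{0}. canonical_char (b * x)) = (if b = 0 then of_nat CARD('a) else 0) - 1"
  using sum_canonical_char_mult[of b] sum.remove[of UNIV 0 "\<lambda>x. canonical_char (b * x)"]
  by (simp add: Compl_eq_Diff_UNIV eq_diff_eq add.commute)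

lemma sum_canonical_char_divide:
  fixes b :: "'a::finite_field"
  shows "(\<Sum>x\<in>-{0}. canonical_char (b / x)) = (if b = 0 then of_nat CARD('a) else 0) - 1"
proof -
  have "(\<Sum>x\<in>-{0}. canonical_char (b / x)) = (\<Sum>x\<in>-{0}. canonical_char (b * x))"
    by (rule sum.reindex_bij_witness[of _ inverse inverse]) (auto simp: field_simps)
  thus ?thesis by (simp add: sum_canonical_char_mult_nonzero)
qed

section \<open>Families of matrices with prescribed eigenspaces\<close>

lemma mat_matrix_mult_component: "(mat c ** M) $ i $ j = c * M $ i $ j"
  for M :: "'a::comm_semiring_1^'m^'n"
  by (simp add: matrix_matrix_mult_def mat_def if_distrib[of "\<lambda>x. x * _"] cong: if_cong)

lemma mat_matrix_mult_vector: "(mat c ** M) *v v = c *s (M *v v)"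
  for M :: "'a::comm_semiring_1^'m^'n"
  by (simp add: vec_eq_iff matrix_vector_mult_def mat_matrix_mult_component sum_distrib_left mult_ac)

lemma matrix_sum_vector: "(\<Sum>i\<in>I. M i) *v v = (\<Sum>i\<in>I. M i *v v)"
  for M :: "'i \<Rightarrow> 'a::comm_semiring_1^'m^'n"
  by (induction I rule: infinite_finite_induct) (simp_all add: matrix_vector_mult_add_rdistrib)

lemma vec_scale_sum_left: "(\<Sum>i\<in>I. c i *s v) = (\<Sum>i\<in>I. c i) *s v"
  for v :: "'a::comm_semiring_1^'n"
  by (simp add: vec_eq_iff sum_distrib_right)

lemma vec_scale_eq_iff: "a *s v = b *s v \<longleftrightarrow> a = b \<or> v = 0"
  for v :: "'a::field^'n"
  by (auto simp: vec_eq_iff)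

text \<open>The data from which everything about the scheme is derived: common eigenspaces
  \<open>V j\<close> that together span the space, and a right inverse \<open>Q\<close> of the
  eigenvalue table \<open>P\<close>. Up to the factor of the order of the matrices, \<open>Q\<close>
  is the usual second eigenmatrix.\<close>

locale eigen_system =
  fixes I :: "'i set" and A :: "'i \<Rightarrow> complex^'x^'x"
    and J :: "'j set" and V :: "'j \<Rightarrow> (complex^'x) set"
    and P :: "'j \<Rightarrow> 'i \<Rightarrow> complex" and Q :: "'i \<Rightarrow> 'j \<Rightarrow> complex"
  assumes finite_I: "finite I" and finite_J: "finite J"
    and V_subspace: "j \<in> J \<Longrightarrow> vec.subspace (V j)"
    and V_nonzero: "j \<in> J \<Longrightarrow> V j \<noteq> {0}"
    and V_span: "vec.span (\<Union>j\<in>J. V j) = UNIV"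
    and eigen: "j \<in> J \<Longrightarrow> i \<in> I \<Longrightarrow> v \<in> V j \<Longrightarrow> A i *v v = P j i *s v"
    and inverse: "j \<in> J \<Longrightarrow> k \<in> J \<Longrightarrow> (\<Sum>i\<in>I. P j i * Q i k) = (if j = k then 1 else 0)"
begin

abbreviation BM :: "(complex^'x^'x) set" where
  "BM \<equiv> bose_mesner_algebra I A"

text \<open>The candidate for the projection onto \<open>V k\<close>: on \<open>V j\<close> its
  eigenvalue is the entry of the product \<open>P Q\<close> at \<open>(j, k)\<close>.\<close>

definition E :: "'j \<Rightarrow> complex^'x^'x" where
  "E k = (\<Sum>i\<in>I. mat (Q i k) ** A i)"

lemma obtain_nonzero:
  assumes "j \<in> J" obtains v where "v \<in> V j" "v \<noteq> 0"
  using V_nonzero[OF assms] V_subspace[OF assms] vec.subspace_0 by blast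

text \<open>The vectors on which two matrices agree form a subspace, so matrix identities may be
  checked on one \<open>V j\<close> at a time.\<close>

lemma matrix_eqI:
  assumes "\<And>j v. j \<in> J \<Longrightarrow> v \<in> V j \<Longrightarrow> M *v v = N *v v"
  shows "M = N"
proof -
  have "vec.subspace {v. M *v v = N *v v}"
    by (auto simp: vec.subspace_def matrix_vector_right_distrib vec.scale)
  hence "vec.span (\<Union>j\<in>J. V j) \<subseteq> {v. M *v v = N *v v}"
    by (intro vec.span_minimal) (use assms in auto)
  thus ?thesis using V_span by (auto simp: matrix_eq)
qed

lemma linear_comb_eigen:
  assumes "j \<in> J" and "v \<in> V j"
  shows "(\<Sum>i\<in>I. mat (c i) ** A i) *v v = (\<Sum>i\<in>I. c i * P j i) *s v"
proof -
  have "(\<Sum>i\<in>I. mat (c i) ** A i) *v v = (\<Sum>i\<in>I. (c i * P j i) *s v)"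
    unfolding matrix_sum_vector mat_matrix_mult_vector
    by (intro sum.cong) (simp_all add: eigen[OF assms(1) _ assms(2)])
  thus ?thesis by (simp add: vec_scale_sum_left)
qed

lemma E_eigen:
  assumes "j \<in> J" and "k \<in> J" and "v \<in> V j"
  shows "E k *v v = (if j = k then v else 0)"
  unfolding E_def using linear_comb_eigen[OF assms(1,3), of "\<lambda>i. Q i k"] inverse[OF assms(1,2)]
  by (simp add: mult.commute)

text \<open>A matrix with eigenvalue \<open>\<theta> k\<close> on each \<open>V k\<close> equals the
  sum of the \<open>\<theta> k\<close> multiples of \<open>E k\<close>, and every \<open>E k\<close>
  is a combination of the adjacency matrices.\<close>

lemma BM_iff: "M \<in> BM \<longleftrightarrow> (\<exists>\<theta>. \<forall>j\<in>J. \<forall>v\<in>V j. M *v v = \<theta> j *s v)"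
proof
  assume "M \<in> BM"
  then obtain c where "M = (\<Sum>i\<in>I. mat (c i) ** A i)"
    by (auto simp: bose_mesner_algebra_def)
  thus "\<exists>\<theta>. \<forall>j\<in>J. \<forall>v\<in>V j. M *v v = \<theta> j *s v"
    by (intro exI[of _ "\<lambda>j. \<Sum>i\<in>I. c i * P j i"]) (simp add: linear_comb_eigen)
next
  assume "\<exists>\<theta>. \<forall>j\<in>J. \<forall>v\<in>V j. M *v v = \<theta> j *s v"
  then obtain \<theta> where \<theta>: "\<And>j v. j \<in> J \<Longrightarrow> v \<in> V j \<Longrightarrow> M *v v = \<theta> j *s v" by blast
  \<comment> \<open>The coefficient of \<open>A i\<close> in the sum over \<open>k\<close> of the
    \<open>\<theta> k\<close> multiples of \<open>E k\<close>.\<close>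
  define c where "c = (\<lambda>i. \<Sum>k\<in>J. \<theta> k * Q i k)"
  have "M = (\<Sum>i\<in>I. mat (c i) ** A i)"
  proof (rule matrix_eqI)
    fix j v assume jv: "j \<in> J" "v \<in> V j"
    have "(\<Sum>i\<in>I. c i * P j i) = (\<Sum>i\<in>I. \<Sum>k\<in>J. \<theta> k * (P j i * Q i k))"
      unfolding c_def by (simp add: sum_distrib_left sum_distrib_right mult_ac)
    also have "\<dots> = (\<Sum>k\<in>J. \<theta> k * (\<Sum>i\<in>I. P j i * Q i k))"
      by (subst sum.swap) (simp add: sum_distrib_left)
    also have "\<dots> = (\<Sum>k\<in>J. if k = j then \<theta> k else 0)"
      by (intro sum.cong) (auto simp: inverse jv)
    also have "\<dots> = \<theta> j" using jv finite_J by simp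
    finally show "M *v v = (\<Sum>i\<in>I. mat (c i) ** A i) *v v"
      by (simp only: linear_comb_eigen[OF jv] \<theta>[OF jv])
  qed
  thus "M \<in> BM" by (auto simp: bose_mesner_algebra_def)
qed

lemma E_in_BM: "k \<in> J \<Longrightarrow> E k \<in> BM"
  unfolding BM_iff by (intro exI[of _ "\<lambda>j. if j = k then 1 else 0"]) (simp add: E_eigen)

lemma E_nonzero: "k \<in> J \<Longrightarrow> E k \<noteq> 0"
  by (metis E_eigen matrix_vector_mult_0 obtain_nonzero)

lemma A_commute:
  assumes "i \<in> I" and "j \<in> I"
  shows "A i ** A j = A j ** A i"
  by (rule matrix_eqI)
    (simp add: matrix_vector_mul_assoc[symmetric] eigen assms vec.scale mult.commute)

lemma A_mult_in_BM:
  assumes "i \<in> I" and "j \<in> I"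
  shows "A i ** A j \<in> BM"
  unfolding BM_iff
  by (rule exI[of _ "\<lambda>k. P k i * P k j"])
    (simp add: matrix_vector_mul_assoc[symmetric] eigen assms vec.scale mult.commute)

lemma range_E:
  assumes "k \<in> J"
  shows "range (\<lambda>v. E k *v v) = V k"
proof
  show "V k \<subseteq> range (\<lambda>v. E k *v v)"
  proof
    fix v assume "v \<in> V k"
    hence "v = E k *v v" using E_eigen[OF assms assms] by simp
    thus "v \<in> range (\<lambda>v. E k *v v)" by blast
  qed
  have "vec.subspace {v. E k *v v \<in> V k}"
    using V_subspace[OF assms]
    by (auto simp: vec.subspace_def matrix_vector_right_distrib vec.scale)
  moreover have "(\<Union>j\<in>J. V j) \<subseteq> {v. E k *v v \<in> V k}"
    using vec.subspace_0[OF V_subspace[OF assms]] by (auto simp: E_eigen assms)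
  ultimately have "vec.span (\<Union>j\<in>J. V j) \<subseteq> {v. E k *v v \<in> V k}"
    by (intro vec.span_minimal)
  thus "range (\<lambda>v. E k *v v) \<subseteq> V k" using V_span by auto
qed

section \<open>Primitive idempotents\<close>

lemma idempotent_eigenvalue:
  assumes "j \<in> J" and "\<And>v. v \<in> V j \<Longrightarrow> F *v v = t *s v" and "F ** F = F"
  shows "t = 0 \<or> t = 1"
proof -
  obtain v where v: "v \<in> V j" "v \<noteq> 0" using obtain_nonzero assms(1) by blast
  have "(t * t) *s v = t *s v"
    using arg_cong[OF assms(3), of "\<lambda>M. M *v v"] assms(2)[OF v(1)]
    by (simp add: matrix_vector_mul_assoc[symmetric] vec.scale)
  thus ?thesis using v by (auto simp: vec_scale_eq_iff)
qed

lemma E_idempotent: "k \<in> J \<Longrightarrow> E k ** E k = E k"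
  by (rule matrix_eqI) (auto simp: matrix_vector_mul_assoc[symmetric] dest: E_eigen split: if_splits)

text \<open>In a splitting \<open>E k = F + G\<close> into idempotents, \<open>F\<close> and
  \<open>G\<close> have eigenvalues 0 or 1 on every \<open>V j\<close>. These add up to 0 off
  \<open>V k\<close> and to 1 on it, so one of the two summands is zero everywhere.\<close>

lemma primitive_idempotent_E:
  assumes k: "k \<in> J"
  shows "primitive_idempotent BM (E k)"
  unfolding primitive_idempotent_def
proof (intro conjI notI)
  show "E k \<in> BM" "E k ** E k = E k"
    using k E_in_BM E_idempotent by blast+
  show False if "E k = 0"
    using that k E_nonzero by blast
  assume "\<exists>F\<in>BM. \<exists>G\<in>BM. F \<noteq> 0 \<and> G \<noteq> 0 \<and> F ** F = F \<and> G ** G = G \<and>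
    F ** G = 0 \<and> G ** F = 0 \<and> E k = F + G"
  then obtain F G where FG: "F \<in> BM" "G \<in> BM" "F \<noteq> 0" "G \<noteq> 0" "F ** F = F" "G ** G = G"
    "E k = F + G" by blast
  obtain f where f: "\<And>j v. j \<in> J \<Longrightarrow> v \<in> V j \<Longrightarrow> F *v v = f j *s v"
    using FG(1) unfolding BM_iff by blast
  obtain g where g: "\<And>j v. j \<in> J \<Longrightarrow> v \<in> V j \<Longrightarrow> G *v v = g j *s v"
    using FG(2) unfolding BM_iff by blast
  have f01: "f j = 0 \<or> f j = 1" and g01: "g j = 0 \<or> g j = 1" if "j \<in> J" for j
    using idempotent_eigenvalue[OF that f FG(5)] idempotent_eigenvalue[OF that g FG(6)] that by blast+
  have sum: "f j + g j = (if j = k then 1 else 0)" if j: "j \<in> J" for j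
  proof -
    obtain v where v: "v \<in> V j" "v \<noteq> 0" using obtain_nonzero j by blast
    have "(f j + g j) *s v = E k *v v"
      using v f[OF j] g[OF j]
      by (simp add: FG(7) matrix_vector_mult_add_rdistrib vec.scale_left_distrib)
    also have "\<dots> = (if j = k then 1 else 0) *s v" by (simp add: E_eigen[OF j k v(1)])
    finally show ?thesis using v by (simp only: vec_scale_eq_iff) auto
  qed
  have off: "f j = 0 \<and> g j = 0" if "j \<in> J" "j \<noteq> k" for j
    using sum[OF that(1)] f01[OF that(1)] g01[OF that(1)] that(2) by auto
  have "f k = 0 \<or> g k = 0"
    using sum[OF k] f01[OF k] g01[OF k] by auto
  hence "F = 0 \<or> G = 0"
  proof
    assume "f k = 0"
    hence "F = 0" by (intro matrix_eqI) (metis f off matrix_vector_mult_0 vec.scale_zero_left)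
    thus ?thesis ..
  next
    assume "g k = 0"
    hence "G = 0" by (intro matrix_eqI) (metis g off matrix_vector_mult_0 vec.scale_zero_left)
    thus ?thesis ..
  qed
  thus False using FG by blast
qed

text \<open>A nonzero idempotent \<open>F\<close> of the algebra has eigenvalue 1 on some
  \<open>V k\<close>. Then \<open>F = E k + (F - E k)\<close> is an orthogonal splitting inside the
  algebra, and primitivity forces the second summand to vanish.\<close>

lemma primitive_idempotent_imp_E:
  assumes "primitive_idempotent BM F"
  shows "\<exists>k\<in>J. F = E k"
proof -
  have F: "F \<in> BM" "F \<noteq> 0" "F ** F = F" using assms by (auto simp: primitive_idempotent_def)
  obtain f where f: "\<And>j v. j \<in> J \<Longrightarrow> v \<in> V j \<Longrightarrow> F *v v = f j *s v"
    using F(1) unfolding BM_iff by blast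
  have f01: "f j = 0 \<or> f j = 1" if "j \<in> J" for j
    using idempotent_eigenvalue[OF that f F(3)] that by blast
  obtain k where k: "k \<in> J" "f k = 1"
  proof -
    have "\<not> (\<forall>j\<in>J. f j = 0)"
    proof
      assume "\<forall>j\<in>J. f j = 0"
      hence "F = 0" by (intro matrix_eqI) (metis f matrix_vector_mult_0 vec.scale_zero_left)
      thus False using F by blast
    qed
    thus thesis using that f01 by blast
  qed
  define G where "G = F - E k"
  have G: "G *v v = (if j = k then 0 else f j *s v)" if "j \<in> J" "v \<in> V j" for j v
    unfolding G_def using that k by (simp add: matrix_vector_mult_diff_rdistrib f E_eigen)
  have "G \<in> BM"
    unfolding BM_iff by (rule exI[of _ "\<lambda>j. if j = k then 0 else f j"]) (simp add: G)
  moreover have "G ** G = G"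
    by (rule matrix_eqI)
      (use f01 in \<open>force simp: matrix_vector_mul_assoc[symmetric] G vec.scale\<close>)
  moreover have "E k ** G = 0 \<and> G ** E k = 0"
  proof (intro conjI; rule matrix_eqI)
    fix j v assume jv: "j \<in> J" "v \<in> V j"
    note ev = G[OF jv] E_eigen[OF jv(1) k(1) jv(2)]
    show "(E k ** G) *v v = 0 *v v" "(G ** E k) *v v = 0 *v v"
      by (simp_all add: matrix_vector_mul_assoc[symmetric] ev vec.scale)
  qed
  moreover have "F = E k + G" by (simp add: G_def)
  ultimately have "G = 0"
    using assms E_in_BM[OF k(1)] E_nonzero[OF k(1)] E_idempotent[OF k(1)]
    unfolding primitive_idempotent_def by blast
  thus ?thesis using k by (auto simp: G_def)
qed

text \<open>\<open>E k\<close> fixes the vectors of \<open>V k\<close> but kills those of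
  \<open>V l\<close> when the labels differ. Inclusion instead of equality is what the maximality
  argument uses.\<close>

lemma V_inj:
  assumes "k \<in> J" "l \<in> J" "V k \<subseteq> V l"
  shows "k = l"
proof -
  obtain v where v: "v \<in> V k" "v \<noteq> 0" using obtain_nonzero assms by blast
  thus ?thesis using E_eigen[of k k v] E_eigen[of l k v] assms by (auto split: if_splits)
qed

theorem first_eigenmatrix: "first_eigenmatrix I A J V P"
proof -
  have "{range (\<lambda>v. F *v v) | F. primitive_idempotent BM F} = V ` J" (is "?L = _")
  proof (intro set_eqI iffI)
    fix U assume "U \<in> ?L"
    then obtain F where F: "primitive_idempotent BM F" "U = range (\<lambda>v. F *v v)" by blast
    then obtain k where "k \<in> J" "F = E k" using primitive_idempotent_imp_E by blast
    thus "U \<in> V ` J" using F range_E by auto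
  next
    fix U assume "U \<in> V ` J"
    then obtain k where "k \<in> J" "U = V k" by blast
    thus "U \<in> ?L" using primitive_idempotent_E[of k] range_E[of k] by blast
  qed
  moreover have "inj_on V J" using V_inj by (auto simp: inj_on_def)
  ultimately show ?thesis
    using eigen by (auto simp: first_eigenmatrix_def bij_betw_def)
qed

section \<open>Maximal common eigenspaces\<close>

lemma common_eigenspace_V: "j \<in> J \<Longrightarrow> common_eigenspace I A (V j)"
  using V_subspace V_nonzero eigen unfolding common_eigenspace_def by blast

text \<open>Each \<open>E k\<close>, being a combination of the \<open>A i\<close>, acts on
  \<open>W\<close> as a scalar \<open>t k\<close>. The \<open>E k\<close> sum to the identity, so
  some \<open>t k\<close> is nonzero, and then \<open>W\<close> lies in the image of
  \<open>E k\<close>.\<close>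

lemma common_eigenspace_subset:
  assumes "common_eigenspace I A W"
  shows "\<exists>k\<in>J. W \<subseteq> V k"
proof -
  obtain \<theta> where \<theta>: "\<And>i v. i \<in> I \<Longrightarrow> v \<in> W \<Longrightarrow> A i *v v = \<theta> i *s v"
    using assms unfolding common_eigenspace_def by metis
  obtain w where w: "w \<in> W" "w \<noteq> 0"
    using assms vec.subspace_0 unfolding common_eigenspace_def by blast
  define t where "t = (\<lambda>k. \<Sum>i\<in>I. Q i k * \<theta> i)"
  have t: "E k *v v = t k *s v" if "v \<in> W" for k v
    using that unfolding E_def t_def matrix_sum_vector mat_matrix_mult_vector
    by (simp add: \<theta> vec_scale_sum_left)
  have "\<exists>k\<in>J. t k \<noteq> 0"
  proof (rule ccontr)
    assume none: "\<not> ?thesis"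
    have "(\<Sum>k\<in>J. E k) = mat 1"
    proof (rule matrix_eqI)
      fix j v assume "j \<in> J" "v \<in> V j"
      thus "(\<Sum>k\<in>J. E k) *v v = mat 1 *v v"
        using finite_J by (simp add: matrix_sum_vector E_eigen)
    qed
    hence "w = (\<Sum>k\<in>J. E k *v w)" by (metis matrix_sum_vector matrix_vector_mul_lid)
    also have "\<dots> = 0" using none by (simp add: t w)
    finally show False using w by simp
  qed
  then obtain k where k: "k \<in> J" "t k \<noteq> 0" by blast
  have "W \<subseteq> V k"
  proof
    fix v assume "v \<in> W"
    hence "t k *s v \<in> V k" using t range_E[OF k(1)] by (metis rangeI)
    hence "inverse (t k) *s (t k *s v) \<in> V k"
      using V_subspace[OF k(1)] vec.subspace_scale by blast
    thus "v \<in> V k" using k by simp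
  qed
  thus ?thesis using k by blast
qed

theorem bij_betw_maximal_common_eigenspaces:
  "bij_betw V J {U. maximal_common_eigenspace I A U}"
proof -
  have "maximal_common_eigenspace I A (V j)" if j: "j \<in> J" for j
    unfolding maximal_common_eigenspace_def
  proof (intro conjI allI impI)
    show "common_eigenspace I A (V j)" using j by (rule common_eigenspace_V)
    fix W assume W: "common_eigenspace I A W \<and> V j \<subseteq> W"
    then obtain k where "k \<in> J" "W \<subseteq> V k" using common_eigenspace_subset by blast
    thus "W = V j" using W V_inj[of j k] j by auto
  qed
  moreover have "U \<in> V ` J" if U: "maximal_common_eigenspace I A U" for U
  proof -
    obtain k where "k \<in> J" "U \<subseteq> V k"
      using U common_eigenspace_subset unfolding maximal_common_eigenspace_def by blast
    thus ?thesis
      using U common_eigenspace_V unfolding maximal_common_eigenspace_def by blast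
  qed
  moreover have "inj_on V J" using V_inj by (auto simp: inj_on_def)
  ultimately show ?thesis by (auto simp: bij_betw_def)
qed

text \<open>The intersection numbers are natural because the coefficient of \<open>A k\<close> in \<open>A i ** A j\<close> can be
  read off at any position where \<open>A k\<close> has a one.\<close>

theorem commutative_association_scheme:
  assumes i0: "i0 \<in> I" "A i0 = mat 1"
    and nonzero: "\<And>i. i \<in> I \<Longrightarrow> A i \<noteq> 0"
    and entries: "\<And>i x y. i \<in> I \<Longrightarrow> A i $ x $ y \<in> {0, 1}"
    and total: "(\<Sum>i\<in>I. A i) = all_ones"
    and transp: "\<And>i. i \<in> I \<Longrightarrow> \<exists>j\<in>I. transpose (A i) = A j"
  shows "commutative_association_scheme i0 I A"
proof -
  \<comment> \<open>At each position the entries are 0 or 1 and sum to 1, so two of them cannot both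
    be 1. Real parts are compared because the estimate needs an order.\<close>
  have disj: "A l $ x $ y = 0" if kl: "k \<in> I" "l \<in> I" "l \<noteq> k" "A k $ x $ y = 1" for k l x y
  proof (rule ccontr)
    assume "A l $ x $ y \<noteq> 0"
    hence l: "A l $ x $ y = 1" using entries[OF kl(2)] by auto
    have re: "Re (A i $ x $ y) \<ge> 0" if "i \<in> I" for i using entries[OF that, of x y] by auto
    have "(\<Sum>i\<in>I. A i $ x $ y) = 1"
      using arg_cong[OF total, of "\<lambda>M. M $ x $ y"] by (simp add: all_ones_def)
    hence "(\<Sum>i\<in>I. Re (A i $ x $ y)) = 1" by (metis Re_sum one_complex.simps(1))
    moreover have "(\<Sum>i\<in>{k, l}. Re (A i $ x $ y)) \<le> (\<Sum>i\<in>I. Re (A i $ x $ y))"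
      using kl re finite_I by (intro sum_mono2) auto
    ultimately show False using kl l by simp
  qed
  have "\<exists>p :: 'i \<Rightarrow> nat. A i ** A j = (\<Sum>k\<in>I. of_nat (p k) *\<^sub>R A k)" if ij: "i \<in> I" "j \<in> I" for i j
  proof -
    obtain c where c: "A i ** A j = (\<Sum>k\<in>I. mat (c k) ** A k)"
      using A_mult_in_BM[OF ij] by (auto simp: bose_mesner_algebra_def)
    have "\<exists>n :: nat. c k = of_nat n" if k: "k \<in> I" for k
    proof -
      obtain x y where "A k $ x $ y \<noteq> 0" using nonzero[OF k] by (auto simp: vec_eq_iff)
      hence xy: "A k $ x $ y = 1" using entries[OF k, of x y] by auto
      have "(A i ** A j) $ x $ y = (\<Sum>l\<in>I. c l * A l $ x $ y)"
        by (simp add: c mat_matrix_mult_component)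
      also have "\<dots> = (\<Sum>l\<in>I. if l = k then c k else 0)"
        using disj[OF k _ _ xy] xy by (intro sum.cong) auto
      also have "\<dots> = c k" using k finite_I by simp
      finally have "c k = (\<Sum>z\<in>UNIV. A i $ x $ z * A j $ z $ y)"
        by (simp add: matrix_matrix_mult_def)
      \<comment> \<open>Every product of entries is 0 or 1, so the sum counts the intermediate
        points \<open>z\<close>.\<close>
      also have "\<dots> = (\<Sum>z\<in>UNIV. of_nat (if A i $ x $ z * A j $ z $ y = 1 then 1 else 0))"
      proof (rule sum.cong)
        show "A i $ x $ z * A j $ z $ y = of_nat (if A i $ x $ z * A j $ z $ y = 1 then 1 else 0)" for z
          using entries[OF ij(1), of x z] entries[OF ij(2), of z y] by auto
      qed simp
      also have "\<dots> = of_nat (\<Sum>z\<in>UNIV. if A i $ x $ z * A j $ z $ y = 1 then 1 else 0)"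
        by (rule of_nat_sum[symmetric])
      finally show ?thesis by blast
    qed
    then obtain p where p: "\<And>k. k \<in> I \<Longrightarrow> c k = of_nat (p k :: nat)" by metis
    have "A i ** A j = (\<Sum>k\<in>I. of_nat (p k) *\<^sub>R A k)"
      unfolding c
    proof (rule sum.cong)
      fix k assume "k \<in> I"
      thus "mat (c k) ** A k = of_nat (p k) *\<^sub>R A k"
        by (simp add: vec_eq_iff mat_matrix_mult_component p scaleR_conv_of_real[where 'a = complex])
    qed simp
    thus ?thesis by blast
  qed
  then obtain p where
    "\<And>i j. i \<in> I \<Longrightarrow> j \<in> I \<Longrightarrow> A i ** A j = (\<Sum>k\<in>I. of_nat (p i j k :: nat) *\<^sub>R A k)"
    by metis
  thus ?thesis
    using assms A_commute finite_I unfolding commutative_association_scheme_def by blast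
qed

end

section \<open>Characters of \<open>\<F>\<^sub>q\<^sub>+\<^sub>2 \<times> \<F>\<^sub>q \<times> \<F>\<^sub>q\<close>\<close>

lemma sum_UNIV_triple:
  "(\<Sum>d\<in>UNIV. f d) = (\<Sum>b\<in>UNIV. \<Sum>a1\<in>UNIV. \<Sum>a2\<in>UNIV. f (b, a1, a2))"
  for f :: "'a::finite \<times> 'b::finite \<times> 'c::finite \<Rightarrow> 'd::comm_monoid_add"
  by (simp add: sum.cartesian_product flip: UNIV_Times_UNIV)

lemma char_vec_nth:
  "char_vec b a1 a2 $ (x, y, z) = canonical_char (b * x) * canonical_char (a1 * y) * canonical_char (a2 * z)"
  by (simp add: char_vec_def canonical_char_add)

lemma char_vec_add: "char_vec b a1 a2 $ (s + t) = char_vec b a1 a2 $ s * char_vec b a1 a2 $ t"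
  by (cases s; cases t) (simp add: char_vec_nth distrib_left canonical_char_add mult_ac)

lemma char_vec_nonzero: "char_vec b a1 a2 \<noteq> 0"
proof
  assume "char_vec b a1 a2 = 0"
  hence "char_vec b a1 a2 $ (0, 0, 0) = 0" by simp
  thus False by (simp add: char_vec_nth)
qed

text \<open>Substituting \<open>t = s + d\<close> splits off the factor
  \<open>char_vec b a1 a2 $ s\<close>; what remains is the Fourier transform of \<open>f\<close> at
  the character.\<close>

lemma translation_invariant_char_vec:
  fixes f :: "'g::finite_field \<times> 'f::finite_field \<times> 'f \<Rightarrow> complex"
  assumes "\<And>s t. M $ s $ t = f (t - s)"
  shows "M *v char_vec b a1 a2 = (\<Sum>d\<in>UNIV. f d * char_vec b a1 a2 $ d) *s char_vec b a1 a2"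
proof (simp add: vec_eq_iff matrix_vector_mult_def assms del: split_paired_All, intro allI)
  fix s :: "'g \<times> 'f \<times> 'f"
  let ?c = "char_vec b a1 a2 :: complex^('g \<times> 'f \<times> 'f)"
  have "(\<Sum>t\<in>UNIV. f (t - s) * ?c $ t) = (\<Sum>d\<in>UNIV. f d * ?c $ (s + d))"
    by (rule sum.reindex_bij_witness[of _ "\<lambda>d. s + d" "\<lambda>t. t - s"]) auto
  thus "(\<Sum>t\<in>UNIV. f (t - s) * ?c $ t) = (\<Sum>d\<in>UNIV. f d * ?c $ d) * ?c $ s"
    by (simp add: char_vec_add sum_distrib_left sum_distrib_right mult_ac)
qed

text \<open>Column orthogonality of the character table: the summation runs over all characters, and
  the sum factors into one sum per coordinate.\<close>

lemma sum_char_vec: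
  fixes s t :: "'g::finite_field \<times> 'f::finite_field \<times> 'f"
  shows "(\<Sum>(b, a1, a2)\<in>UNIV. cnj (char_vec b a1 a2 $ s) * char_vec b a1 a2 $ t) =
    (if s = t then of_nat (CARD('g) * CARD('f)\<^sup>2) else 0)"
proof -
  obtain x y z x' y' z' where st: "s = (x, y, z)" "t = (x', y', z')" by (cases s; cases t)
  have summand: "cnj (char_vec b a1 a2 $ s) * char_vec b a1 a2 $ t =
    canonical_char ((x' - x) * b) * (canonical_char ((y' - y) * a1) * canonical_char ((z' - z) * a2))"
    for b :: 'g and a1 a2 :: 'f
  proof -
    have diff: "canonical_char ((w' - w) * u) = canonical_char (- (u * w)) * canonical_char (u * w')"
      for u w w' :: "'b::finite_field"
      by (simp add: canonical_char_add[symmetric] algebra_simps)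
    show ?thesis
      unfolding st char_vec_nth complex_cnj_mult cnj_canonical_char diff by (simp only: mult_ac)
  qed
  have "(\<Sum>(b, a1, a2)\<in>UNIV. cnj (char_vec b a1 a2 $ s) * char_vec b a1 a2 $ t) =
    (\<Sum>b\<in>UNIV. canonical_char ((x' - x) * b)) *
    ((\<Sum>a1\<in>UNIV. canonical_char ((y' - y) * a1)) * (\<Sum>a2\<in>UNIV. canonical_char ((z' - z) * a2)))"
    by (simp add: sum_UNIV_triple summand flip: sum_distrib_left sum_distrib_right)
  thus ?thesis
    by (auto simp: sum_canonical_char_mult st power2_eq_square)
qed

text \<open>Fourier inversion writes each standard basis vector as a combination of characters, with
  the conjugate values at its position as coefficients.\<close>

lemma span_char_vec:
  "vec.span {char_vec b a1 a2 | b a1 a2. True} = (UNIV :: (complex^('g::finite_field \<times> 'f::finite_field \<times> 'f)) set)"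
  (is "?S = _")
proof -
  have axis: "axis s 1 \<in> ?S" for s :: "'g \<times> 'f \<times> 'f"
  proof -
    let ?n = "of_nat (CARD('g) * CARD('f)\<^sup>2) :: complex"
    have n: "?n \<noteq> 0" by simp
    have "axis s 1 = (\<Sum>(b, a1, a2)\<in>UNIV. (cnj (char_vec b a1 a2 $ s) / ?n) *s char_vec b a1 a2)"
      (is "_ = ?r")
    proof (simp only: vec_eq_iff, intro allI)
      fix t
      have "?r $ t = (\<Sum>(b, a1, a2)\<in>UNIV. cnj (char_vec b a1 a2 $ s) * char_vec b a1 a2 $ t) / ?n"
        by (simp add: case_prod_unfold sum_divide_distrib)
      also have "\<dots> = (if s = t then 1 else 0)"
        unfolding sum_char_vec using n by simp
      finally show "axis s 1 $ t = ?r $ t" by (simp add: axis_def)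
    qed
    also have "\<dots> \<in> ?S"
      by (intro vec.span_sum) (auto intro!: vec.span_scale intro: vec.span_base)
    finally show ?thesis .
  qed
  have "x \<in> ?S" for x :: "complex^('g \<times> 'f \<times> 'f)"
  proof -
    have "(\<Sum>i\<in>UNIV. (x $ i) *s axis i 1) \<in> ?S"
      by (intro vec.span_sum vec.span_scale axis)
    thus ?thesis by (simp only: basis_expansion)
  qed
  thus ?thesis by blast
qed

section \<open>The relations of the scheme\<close>

text \<open>The finite points and \<open>SymY\<close> of \<open>'f ext\<close> index the lines through the origin of the affine plane;
  \<open>SymX\<close> indexes the empty set.\<close>

fun on_line :: "'f::field ext \<Rightarrow> 'f \<Rightarrow> 'f \<Rightarrow> bool" where
  "on_line (Elem c) a1 a2 \<longleftrightarrow> a2 = c * a1"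
| "on_line SymY a1 a2 \<longleftrightarrow> a1 = 0"
| "on_line SymX a1 a2 \<longleftrightarrow> False"

text \<open>The label of the line on which the character \<open>\<chi>(\<alpha>\<^sub>1 a\<^sub>1 + \<alpha>\<^sub>2 a\<^sub>2)\<close> is trivial.\<close>

definition perp_line :: "'f::field \<Rightarrow> 'f \<Rightarrow> 'f ext" where
  "perp_line \<alpha>1 \<alpha>2 = (if \<alpha>2 = 0 then SymY else Elem (- \<alpha>1 / \<alpha>2))"

text \<open>Relations as sets of differences \<open>t - s\<close>. For \<open>R3 \<beta>\<close> the
  origin of the plane is removed, which is the effect of subtracting the matrix of \<open>R1\<close>
  from \<open>N_mat\<close>.\<close>

fun rel_diff :: "('g::finite_field \<Rightarrow> 'f::finite_field ext) \<Rightarrow> 'g rel_label \<Rightarrow> 'g \<times> 'f \<times> 'f \<Rightarrow> bool" where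
  "rel_diff \<phi> R0 (b, a1, a2) \<longleftrightarrow> b = 0 \<and> a1 = 0 \<and> a2 = 0"
| "rel_diff \<phi> R1 (b, a1, a2) \<longleftrightarrow> b \<noteq> 0 \<and> a1 = 0 \<and> a2 = 0"
| "rel_diff \<phi> R2 (b, a1, a2) \<longleftrightarrow> b = 0 \<and> (a1, a2) \<noteq> (0, 0)"
| "rel_diff \<phi> (R3 \<beta>) (b, a1, a2) \<longleftrightarrow> on_line (\<phi> (\<beta> * b)) a1 a2 \<and> (a1, a2) \<noteq> (0, 0)"

lemma N_mat_nth:
  "N_mat \<phi> \<beta> $ s $ t = of_bool (case t - s of (b, a1, a2) \<Rightarrow> on_line (\<phi> (\<beta> * b)) a1 a2)"
  by (cases s; cases t) (auto simp: N_mat_def split: ext.splits)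

text \<open>Restricted to a line, a character of the plane is a character of the field, so it sums
  to the field size if trivial there and to 0 otherwise. The trivial character is listed separately
  because it is trivial on every line, while \<open>perp_line 0 0\<close> is merely the default
  \<open>SymY\<close>.\<close>

lemma sum_on_line:
  fixes \<alpha>1 \<alpha>2 :: "'f::finite_field"
  assumes "c \<noteq> SymX"
  shows "(\<Sum>a1\<in>UNIV. \<Sum>a2\<in>UNIV. of_bool (on_line c a1 a2) *
      (canonical_char (\<alpha>1 * a1) * canonical_char (\<alpha>2 * a2))) =
    (if (\<alpha>1, \<alpha>2) = (0, 0) \<or> c = perp_line \<alpha>1 \<alpha>2 then of_nat CARD('f) else 0)"
proof (cases c)
  case (Elem k)
  have "(\<Sum>a2\<in>UNIV. of_bool (a2 = k * a1) * (canonical_char (\<alpha>1 * a1) * canonical_char (\<alpha>2 * a2))) =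
    canonical_char ((\<alpha>1 + k * \<alpha>2) * a1)" for a1
  proof -
    have "(\<Sum>a2\<in>UNIV. of_bool (a2 = k * a1) * (canonical_char (\<alpha>1 * a1) * canonical_char (\<alpha>2 * a2))) =
      (\<Sum>a2\<in>UNIV. if a2 = k * a1 then canonical_char (\<alpha>1 * a1) * canonical_char (\<alpha>2 * a2) else 0)"
      by (intro sum.cong) auto
    also have "\<dots> = canonical_char ((\<alpha>1 + k * \<alpha>2) * a1)"
      by (simp add: canonical_char_add[symmetric] algebra_simps)
    finally show ?thesis .
  qed
  moreover have "\<alpha>1 + k * \<alpha>2 = 0 \<longleftrightarrow> (\<alpha>1, \<alpha>2) = (0, 0) \<or> c = perp_line \<alpha>1 \<alpha>2"
    by (auto simp: perp_line_def Elem field_simps eq_neg_iff_add_eq_0)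
  ultimately show ?thesis by (simp add: Elem sum_canonical_char_mult)
next
  case SymY
  have "(\<Sum>a1\<in>UNIV. \<Sum>a2\<in>UNIV. of_bool (on_line c a1 a2) *
      (canonical_char (\<alpha>1 * a1) * canonical_char (\<alpha>2 * a2))) =
    (\<Sum>a1\<in>(UNIV :: 'f set). if a1 = 0 then \<Sum>a2\<in>UNIV. canonical_char (\<alpha>2 * a2) else 0)"
    by (intro sum.cong) (auto simp: SymY)
  also have "\<dots> = (if \<alpha>2 = 0 then of_nat CARD('f) else 0)"
    by (simp add: sum_canonical_char_mult)
  also have "\<alpha>2 = 0 \<longleftrightarrow> (\<alpha>1, \<alpha>2) = (0, 0) \<or> c = perp_line \<alpha>1 \<alpha>2"
    by (auto simp: perp_line_def SymY)
  finally show ?thesis .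
qed (use assms in auto)

lemma line_through_point:
  assumes "(a1, a2) \<noteq> (0, 0 :: 'f::field)"
  shows "\<exists>!c. on_line c a1 a2"
proof (cases "a1 = 0")
  case True
  thus ?thesis using assms by (intro ex1I[of _ SymY]) (auto elim: on_line.elims)
next
  case False
  thus ?thesis by (intro ex1I[of _ "Elem (a2 / a1)"]) (auto elim: on_line.elims)
qed

lemma on_line_minus: "on_line c (- a1) (- a2) = on_line c a1 a2"
  by (cases c) auto

lemma finite_rel_labels: "finite (rel_labels :: 'g::finite_field rel_label set)"
proof -
  have "(rel_labels :: 'g rel_label set) = {R0, R1, R2} \<union> R3 ` (- {0})"
    by (auto simp: rel_labels_def)
  thus ?thesis by (rule ssubst) simp
qed

lemma sum_rel_labels:
  fixes f :: "'g::finite_field rel_label \<Rightarrow> 'b::comm_monoid_add"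
  shows "(\<Sum>r\<in>rel_labels. f r) = f R0 + f R1 + f R2 + (\<Sum>\<beta>\<in>-{0}. f (R3 \<beta>))"
proof -
  have "(\<Sum>r\<in>rel_labels. f r) = (\<Sum>r\<in>{R0, R1, R2} \<union> R3 ` (- {0}). f r)"
    by (rule sum.cong) (auto simp: rel_labels_def)
  also have "\<dots> = (\<Sum>r\<in>{R0, R1, R2}. f r) + (\<Sum>r\<in>R3 ` (- {0}). f r)"
    by (rule sum.union_disjoint) auto
  also have "(\<Sum>r\<in>R3 ` (- {0}). f r) = (\<Sum>\<beta>\<in>-{0}. f (R3 \<beta>))"
    by (subst sum.reindex) (auto simp: inj_on_def)
  finally show ?thesis by (simp add: add.assoc)
qed

section \<open>The relations partition the differences\<close>

locale line_labelling =
  fixes \<phi> :: "'g::finite_field \<Rightarrow> 'f::finite_field ext"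
  assumes bij: "bij \<phi>" and zero: "\<phi> 0 = SymX"
begin

lemma eq_SymX_iff: "\<phi> b = SymX \<longleftrightarrow> b = 0"
  using bij zero by (metis bij_pointE)

lemma eq_iff_inv: "\<phi> b = c \<longleftrightarrow> b = inv \<phi> c"
  using bij by (metis bij_inv_eq_iff)

lemma inv_nonzero: "c \<noteq> SymX \<Longrightarrow> inv \<phi> c \<noteq> 0"
  using eq_iff_inv zero by metis

lemma adjacency_nth:
  assumes "r \<in> rel_labels"
  shows "adjacency \<phi> r $ s $ t = of_bool (rel_diff \<phi> r (t - s))"
proof -
  obtain b a1 a2 b' a1' a2' where st: "s = (b, a1, a2)" "t = (b', a1', a2')"
    by (cases s; cases t)
  show ?thesis
  proof (cases r)
    case (R3 \<beta>)
    hence "\<beta> \<noteq> 0" using assms by (auto simp: rel_labels_def)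
    \<comment> \<open>\<open>SymX\<close> is met only at \<open>x = 0\<close>, and all other labels
      give lines through the origin. Hence the ones of \<open>R1\<close> all occur in
      \<open>N_mat \<phi> \<beta>\<close>, and the difference is again a zero-one matrix.\<close>
    hence "on_line (\<phi> (\<beta> * x)) 0 0 \<longleftrightarrow> x \<noteq> 0" for x
      using eq_SymX_iff[of "\<beta> * x"] by (cases "\<phi> (\<beta> * x)") auto
    thus ?thesis
      by (auto simp: R3 N_mat_nth st kronecker_def all_ones_def mat_def)
  qed (auto simp: st kronecker_def all_ones_def mat_def)
qed

text \<open>The essential case has \<open>b\<close> and the planar part both nonzero. The planar
  part lies on exactly one line \<open>c\<close>, and \<open>\<phi> (\<beta> * b) = c\<close> has
  exactly one solution \<open>\<beta>\<close>, nonzero because \<open>c\<close> is not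
  \<open>SymX\<close>.\<close>

lemma rel_diff_unique: "\<exists>!r. r \<in> rel_labels \<and> rel_diff \<phi> r d"
proof -
  obtain b a1 a2 where d: "d = (b, a1, a2)" by (cases d)
  have R3: "rel_diff \<phi> (R3 \<beta>) d \<Longrightarrow> b \<noteq> 0 \<and> (a1, a2) \<noteq> (0, 0)" for \<beta>
    using zero by (auto simp: d)
  consider "b = 0" | "b \<noteq> 0" "(a1, a2) = (0, 0)" | "b \<noteq> 0" "(a1, a2) \<noteq> (0, 0)" by blast
  thus ?thesis
  proof cases
    case 1
    thus ?thesis using R3
      by (intro ex1I[of _ "if (a1, a2) = (0, 0) then R0 else R2"]) (auto simp: rel_labels_def d)
  next
    case 2
    thus ?thesis using R3
      by (intro ex1I[of _ R1]) (auto simp: rel_labels_def d)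
  next
    case 3
    obtain c where c: "on_line c a1 a2" "\<And>c'. on_line c' a1 a2 \<Longrightarrow> c' = c"
      using line_through_point[OF 3(2)] by blast
    have "c \<noteq> SymX" using c(1) by auto
    hence "inv \<phi> c \<noteq> 0" by (rule inv_nonzero)
    hence label: "R3 (inv \<phi> c / b) \<in> rel_labels" using 3 by (simp add: rel_labels_def)
    have "on_line (\<phi> (\<beta> * b)) a1 a2 \<longleftrightarrow> \<beta> = inv \<phi> c / b" for \<beta>
      using c 3 eq_iff_inv[of "\<beta> * b" c] by (metis nonzero_eq_divide_eq)
    hence R3_iff: "rel_diff \<phi> (R3 \<beta>) d \<longleftrightarrow> \<beta> = inv \<phi> c / b" for \<beta>
      using 3 unfolding d rel_diff.simps by blast
    show ?thesis
    proof (rule ex1I)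
      show "R3 (inv \<phi> c / b) \<in> rel_labels \<and> rel_diff \<phi> (R3 (inv \<phi> c / b)) d"
        using label R3_iff by blast
      show "r = R3 (inv \<phi> c / b)" if "r \<in> rel_labels \<and> rel_diff \<phi> r d" for r
      proof (cases r)
        case (R3 \<beta>)
        thus ?thesis using that R3_iff by blast
      qed (use that 3 d in auto)
    qed
  qed
qed

lemma sum_adjacency: "(\<Sum>r\<in>rel_labels. adjacency \<phi> r) = all_ones"
proof (simp add: vec_eq_iff all_ones_def del: split_paired_All, intro allI)
  fix s t
  obtain r0 where r0: "r0 \<in> rel_labels" "\<And>r. r \<in> rel_labels \<Longrightarrow> rel_diff \<phi> r (t - s) \<longleftrightarrow> r = r0"
    using rel_diff_unique[of "t - s"] by metis
  have "(\<Sum>r\<in>rel_labels. adjacency \<phi> r $ s $ t) = (\<Sum>r\<in>rel_labels. if r = r0 then 1 else 0)"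
    using r0(2) by (intro sum.cong) (auto simp: adjacency_nth)
  thus "(\<Sum>r\<in>rel_labels. adjacency \<phi> r $ s $ t) = 1"
    using r0(1) by (simp add: finite_rel_labels)
qed

lemma adjacency_nonzero:
  assumes r: "r \<in> rel_labels"
  shows "adjacency \<phi> r \<noteq> 0"
proof -
  have "\<exists>d. rel_diff \<phi> r d"
  proof (cases r)
    case R0
    thus ?thesis by (intro exI[of _ "(0, 0, 0)"]) auto
  next
    case R1
    thus ?thesis by (intro exI[of _ "(1, 0, 0)"]) auto
  next
    case R2
    thus ?thesis by (intro exI[of _ "(0, 1, 0)"]) auto
  next
    case (R3 \<beta>)
    hence "\<phi> (\<beta> * (inv \<phi> SymY / \<beta>)) = SymY"
      using r eq_iff_inv by (auto simp: rel_labels_def)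
    \<comment> \<open>The first coordinate is chosen to select the vertical line, which contains the
      point \<open>(0, 1)\<close>.\<close>
    thus ?thesis by (intro exI[of _ "(inv \<phi> SymY / \<beta>, 0, 1)"]) (auto simp: R3)
  qed
  then obtain d where "rel_diff \<phi> r d" by blast
  hence "adjacency \<phi> r $ 0 $ d = 1" by (simp add: adjacency_nth r)
  thus ?thesis by auto
qed

lemma transpose_adjacency:
  assumes r: "r \<in> rel_labels"
  shows "\<exists>r'\<in>rel_labels. transpose (adjacency \<phi> r) = adjacency \<phi> r'"
proof -
  \<comment> \<open>Lines through the origin are symmetric under negation, so reversing a difference
    only changes the sign in \<open>\<beta> * b\<close>, and this sign can be moved to the
    label.\<close>
  define r' where "r' = (case r of R3 \<beta> \<Rightarrow> R3 (- \<beta>) | _ \<Rightarrow> r)"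
  have r': "r' \<in> rel_labels"
    using r by (auto simp: r'_def rel_labels_def split: rel_label.splits)
  have "rel_diff \<phi> r (- d) = rel_diff \<phi> r' d" for d
    by (cases d; cases r) (auto simp: r'_def on_line_minus)
  hence "rel_diff \<phi> r (s - t) = rel_diff \<phi> r' (t - s)" for s t
    by (metis minus_diff_eq)
  hence "transpose (adjacency \<phi> r) = adjacency \<phi> r'"
    by (simp add: vec_eq_iff transpose_def adjacency_nth r r' del: split_paired_All)
  thus ?thesis using r' by blast
qed

section \<open>Eigenvalues\<close>

definition char_eigval :: "'g \<Rightarrow> 'f \<Rightarrow> 'f \<Rightarrow> 'g rel_label \<Rightarrow> complex" where
  "char_eigval b \<alpha>1 \<alpha>2 r = (\<Sum>d\<in>UNIV. of_bool (rel_diff \<phi> r d) * char_vec b \<alpha>1 \<alpha>2 $ d)"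

lemma adjacency_char_vec:
  "r \<in> rel_labels \<Longrightarrow> adjacency \<phi> r *v char_vec b \<alpha>1 \<alpha>2 = char_eigval b \<alpha>1 \<alpha>2 r *s char_vec b \<alpha>1 \<alpha>2"
  unfolding char_eigval_def by (rule translation_invariant_char_vec) (simp add: adjacency_nth)

lemma char_eigval_R0: "char_eigval b \<alpha>1 \<alpha>2 R0 = 1"
proof -
  have "char_eigval b \<alpha>1 \<alpha>2 R0 = (\<Sum>d\<in>(UNIV :: ('g \<times> 'f \<times> 'f) set). if d = (0, 0, 0) then 1 else 0)"
    unfolding char_eigval_def by (intro sum.cong) (auto simp: char_vec_nth)
  thus ?thesis by simp
qed

lemma char_eigval_R1:
  "char_eigval b \<alpha>1 \<alpha>2 R1 = (if b = 0 then of_nat CARD('g) else 0) - 1"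
proof -
  have "char_eigval b \<alpha>1 \<alpha>2 R1 =
    (\<Sum>d\<in>(\<lambda>x. (x, 0, 0)) ` (- {0}). char_vec b \<alpha>1 \<alpha>2 $ d)"
    unfolding char_eigval_def by (rule sum.mono_neutral_cong_right) auto
  also have "\<dots> = (\<Sum>x\<in>- {0}. canonical_char (b * x))"
    by (subst sum.reindex) (auto simp: inj_on_def char_vec_nth)
  finally show ?thesis by (simp add: sum_canonical_char_mult_nonzero)
qed

lemma char_eigval_R2:
  "char_eigval b \<alpha>1 \<alpha>2 R2 = (if (\<alpha>1, \<alpha>2) = (0, 0) then (of_nat CARD('f))\<^sup>2 else 0) - 1"
proof -
  have "char_eigval b \<alpha>1 \<alpha>2 R2 =
    (\<Sum>d\<in>Pair 0 ` (UNIV - {(0, 0)}). char_vec b \<alpha>1 \<alpha>2 $ d)"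
    unfolding char_eigval_def by (rule sum.mono_neutral_cong_right) auto
  also have "\<dots> = (\<Sum>a\<in>UNIV - {(0, 0)}. char_vec b \<alpha>1 \<alpha>2 $ (0, a))"
    by (subst sum.reindex) (auto simp: inj_on_def)
  also have "\<dots> = (\<Sum>a\<in>UNIV. char_vec b \<alpha>1 \<alpha>2 $ (0, a)) - 1"
    by (simp add: sum.remove[of UNIV "(0, 0)"] char_vec_nth)
  also have "(\<Sum>a\<in>UNIV. char_vec b \<alpha>1 \<alpha>2 $ (0, a)) =
    (\<Sum>x\<in>UNIV. canonical_char (\<alpha>1 * x)) * (\<Sum>x\<in>UNIV. canonical_char (\<alpha>2 * x))"
    unfolding sum_product sum.cartesian_product
    by (simp add: char_vec_nth case_prod_unfold flip: UNIV_Times_UNIV)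
       (auto intro!: sum.cong simp: char_vec_nth)
  finally show ?thesis by (auto simp: sum_canonical_char_mult power2_eq_square)
qed

text \<open>Adding back the eigenvalue of \<open>R1\<close> gives that of \<open>N_mat\<close>,
  which is a sum of line sums over nonzero \<open>x\<close>. For a trivial planar part every line
  contributes; otherwise only the \<open>x\<close> whose line is
  \<open>perp_line \<alpha>1 \<alpha>2\<close> does.\<close>

lemma char_eigval_R3:
  assumes \<beta>: "\<beta> \<noteq> 0"
  shows "char_eigval b \<alpha>1 \<alpha>2 (R3 \<beta>) =
    of_nat CARD('f) * (if (\<alpha>1, \<alpha>2) = (0, 0) then (if b = 0 then of_nat CARD('g) else 0) - 1
      else canonical_char (b * inv \<phi> (perp_line \<alpha>1 \<alpha>2) / \<beta>)) - char_eigval b \<alpha>1 \<alpha>2 R1"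
proof -
  let ?q = "of_nat CARD('f) :: complex"
  have on_origin: "on_line (\<phi> (\<beta> * x)) 0 0 \<longleftrightarrow> x \<noteq> 0" for x
    using \<beta> eq_SymX_iff[of "\<beta> * x"] by (cases "\<phi> (\<beta> * x)") auto
  have "char_eigval b \<alpha>1 \<alpha>2 (R3 \<beta>) + char_eigval b \<alpha>1 \<alpha>2 R1 =
    (\<Sum>d\<in>UNIV. of_bool (case d of (x, a1, a2) \<Rightarrow> on_line (\<phi> (\<beta> * x)) a1 a2) * char_vec b \<alpha>1 \<alpha>2 $ d)"
    unfolding char_eigval_def sum.distrib[symmetric]
    by (intro sum.cong) (auto simp: on_origin zero)
  also have "\<dots> = (\<Sum>x\<in>UNIV. canonical_char (b * x) * (\<Sum>a1\<in>UNIV. \<Sum>a2\<in>UNIV.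
      of_bool (on_line (\<phi> (\<beta> * x)) a1 a2) * (canonical_char (\<alpha>1 * a1) * canonical_char (\<alpha>2 * a2))))"
    by (simp add: sum_UNIV_triple char_vec_nth sum_distrib_left mult_ac)
  also have "\<dots> = (\<Sum>x\<in>-{0}. canonical_char (b * x) *
      (if (\<alpha>1, \<alpha>2) = (0, 0) \<or> \<phi> (\<beta> * x) = perp_line \<alpha>1 \<alpha>2 then ?q else 0))"
  proof (rule sum.mono_neutral_cong_right)
    fix x :: 'g assume "x \<in> - {0}"
    hence "\<phi> (\<beta> * x) \<noteq> SymX" using \<beta> eq_SymX_iff by simp
    thus "canonical_char (b * x) * (\<Sum>a1\<in>UNIV. \<Sum>a2\<in>UNIV. of_bool (on_line (\<phi> (\<beta> * x)) a1 a2) *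
        (canonical_char (\<alpha>1 * a1) * canonical_char (\<alpha>2 * a2))) =
      canonical_char (b * x) * (if (\<alpha>1, \<alpha>2) = (0, 0) \<or> \<phi> (\<beta> * x) = perp_line \<alpha>1 \<alpha>2 then ?q else 0)"
      using sum_on_line[of "\<phi> (\<beta> * x)" \<alpha>1 \<alpha>2] by simp
  qed (auto simp: zero)
  also have "\<dots> = ?q * (if (\<alpha>1, \<alpha>2) = (0, 0) then (if b = 0 then of_nat CARD('g) else 0) - 1
      else canonical_char (b * inv \<phi> (perp_line \<alpha>1 \<alpha>2) / \<beta>))"
  proof (cases "(\<alpha>1, \<alpha>2) = (0, 0)")
    case True
    hence "(\<Sum>x\<in>-{0}. canonical_char (b * x) *
        (if (\<alpha>1, \<alpha>2) = (0, 0) \<or> \<phi> (\<beta> * x) = perp_line \<alpha>1 \<alpha>2 then ?q else 0)) =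
      (\<Sum>x\<in>-{0}. canonical_char (b * x)) * ?q"
      by (simp add: sum_distrib_right)
    thus ?thesis unfolding if_P[OF True] sum_canonical_char_mult_nonzero by (simp only: mult.commute)
  next
    case False
    \<comment> \<open>The unique \<open>x\<close> selecting the line on which the planar character
      is trivial. It is nonzero, so it occurs in the sum.\<close>
    define y where "y = inv \<phi> (perp_line \<alpha>1 \<alpha>2) / \<beta>"
    have y: "y \<noteq> 0" using \<beta> inv_nonzero by (simp add: y_def perp_line_def)
    have "\<phi> (\<beta> * x) = perp_line \<alpha>1 \<alpha>2 \<longleftrightarrow> x = y" for x
      using \<beta> by (auto simp: eq_iff_inv y_def field_simps)
    hence "(\<Sum>x\<in>-{0}. canonical_char (b * x) *
        (if (\<alpha>1, \<alpha>2) = (0, 0) \<or> \<phi> (\<beta> * x) = perp_line \<alpha>1 \<alpha>2 then ?q else 0)) =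
      (\<Sum>x\<in>-{0}. if x = y then canonical_char (b * x) * ?q else 0)"
      using False by (intro sum.cong) auto
    also have "\<dots> = canonical_char (b * y) * ?q" using y by simp
    finally show ?thesis unfolding if_not_P[OF False] by (simp add: y_def mult.commute)
  qed
  finally show ?thesis by (simp add: eq_diff_eq)
qed

end

section \<open>The first eigenmatrix\<close>

fun eigenmatrix :: "complex \<Rightarrow> 'g::finite_field eig_label \<Rightarrow> 'g rel_label \<Rightarrow> complex" where
  "eigenmatrix q V0 R0 = 1" | "eigenmatrix q V0 R1 = q + 1"
| "eigenmatrix q V0 R2 = q\<^sup>2 - 1" | "eigenmatrix q V0 (R3 \<beta>) = q\<^sup>2 - 1"
| "eigenmatrix q V1 R0 = 1" | "eigenmatrix q V1 R1 = - 1"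
| "eigenmatrix q V1 R2 = q\<^sup>2 - 1" | "eigenmatrix q V1 (R3 \<beta>) = - q + 1"
| "eigenmatrix q V2 R0 = 1" | "eigenmatrix q V2 R1 = q + 1"
| "eigenmatrix q V2 R2 = - 1" | "eigenmatrix q V2 (R3 \<beta>) = - 1"
| "eigenmatrix q (V3 \<gamma>) R0 = 1" | "eigenmatrix q (V3 \<gamma>) R1 = - 1"
| "eigenmatrix q (V3 \<gamma>) R2 = - 1" | "eigenmatrix q (V3 \<gamma>) (R3 \<beta>) = q * canonical_char (\<gamma> / \<beta>) + 1"

text \<open>Up to the common factor \<open>q\<^sup>2 - 1\<close>, these are the inverses of the valencies.\<close>

fun inverse_valency :: "complex \<Rightarrow> 'g rel_label \<Rightarrow> complex" where
  "inverse_valency q R0 = q\<^sup>2 - 1"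
| "inverse_valency q R1 = q - 1"
| "inverse_valency q R2 = 1"
| "inverse_valency q (R3 \<beta>) = 1"

text \<open>The dimensions of the eigenspaces. For \<open>V3 \<gamma>\<close>, each nonzero pair
  \<open>(\<alpha>1, \<alpha>2)\<close> admits exactly one first parameter \<open>b\<close>.\<close>

fun eig_multiplicity :: "complex \<Rightarrow> 'g eig_label \<Rightarrow> complex" where
  "eig_multiplicity q V0 = 1"
| "eig_multiplicity q V1 = q + 1"
| "eig_multiplicity q V2 = q\<^sup>2 - 1"
| "eig_multiplicity q (V3 \<gamma>) = q\<^sup>2 - 1"

section \<open>Orthogonality of the rows of \<open>P\<close>\<close>

lemma sum_eigenmatrix_V3:
  fixes q :: complex and \<gamma> :: "'g::finite_field"
  assumes "of_nat CARD('g) = q + 2" and "\<gamma> \<noteq> 0"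
  shows "(\<Sum>\<beta>\<in>-{0}. q * canonical_char (\<gamma> / \<beta>) + 1) = 1"
proof -
  have "of_nat (card (- {0 :: 'g})) = q + 1"
    using assms sum_canonical_char_mult_nonzero[of "0 :: 'g"] by simp
  thus ?thesis
    using assms by (simp add: sum.distrib sum_distrib_left[symmetric] sum_canonical_char_divide)
qed

text \<open>The negative sign in the second factor comes from complex conjugation. After expanding,
  the product of the characters depends only on \<open>\<gamma> - \<delta>\<close>, so the case
  distinction is the orthogonality relation for characters.\<close>

lemma sum_eigenmatrix_V3_V3:
  fixes q :: complex and \<gamma> \<delta> :: "'g::finite_field"
  assumes "of_nat CARD('g) = q + 2" and "\<gamma> \<noteq> 0" and "\<delta> \<noteq> 0"
  shows "(\<Sum>\<beta>\<in>-{0}. (q * canonical_char (\<gamma> / \<beta>) + 1) * (q * canonical_char (- (\<delta> / \<beta>)) + 1)) =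
    (if \<gamma> = \<delta> then q\<^sup>2 * (q + 2) else 0) - q\<^sup>2 - q + 1"
proof -
  have "(q * canonical_char (\<gamma> / \<beta>) + 1) * (q * canonical_char (- (\<delta> / \<beta>)) + 1) =
    q\<^sup>2 * canonical_char ((\<gamma> - \<delta>) / \<beta>) + q * canonical_char ((- \<delta>) / \<beta>) +
    (q * canonical_char (\<gamma> / \<beta>) + 1)" for \<beta>
  proof -
    have "canonical_char ((\<gamma> - \<delta>) / \<beta>) = canonical_char (\<gamma> / \<beta>) * canonical_char (- (\<delta> / \<beta>))"
      by (simp add: canonical_char_add[symmetric] diff_divide_distrib)
    thus ?thesis by (simp add: algebra_simps power2_eq_square)
  qed
  hence "(\<Sum>\<beta>\<in>-{0}. (q * canonical_char (\<gamma> / \<beta>) + 1) * (q * canonical_char (- (\<delta> / \<beta>)) + 1)) =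
    q\<^sup>2 * (\<Sum>\<beta>\<in>-{0}. canonical_char ((\<gamma> - \<delta>) / \<beta>)) +
    q * (\<Sum>\<beta>\<in>-{0}. canonical_char ((- \<delta>) / \<beta>)) + (\<Sum>\<beta>\<in>-{0}. q * canonical_char (\<gamma> / \<beta>) + 1)"
    by (simp only: sum.distrib sum_distrib_left)
  also have "\<dots> = (if \<gamma> = \<delta> then q\<^sup>2 * (q + 2) else 0) - q\<^sup>2 - q + 1"
    unfolding sum_canonical_char_divide sum_eigenmatrix_V3[OF assms(1,2)] assms(1)
    using assms(3) by (simp add: algebra_simps)
  finally show ?thesis .
qed

text \<open>The usual weighted row orthogonality, with the inverse valencies scaled by
  \<open>q^2 - 1\<close>; the right-hand side is therefore the order \<open>(q + 2) q^2\<close> of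
  the scheme times that factor. Only the cases involving a \<open>V3\<close> label need character
  sums.\<close>

lemma eigenmatrix_orthogonality:
  fixes q :: complex and j k :: "'g::finite_field eig_label"
  assumes q: "of_nat CARD('g) = q + 2" "cnj q = q" and jk: "j \<in> eig_labels" "k \<in> eig_labels"
  shows "eig_multiplicity q k *
      (\<Sum>i\<in>rel_labels. inverse_valency q i * eigenmatrix q j i * cnj (eigenmatrix q k i)) =
    (if j = k then (q + 2) * q\<^sup>2 * (q\<^sup>2 - 1) else 0)"
proof -
  have card: "of_nat (card (- {0 :: 'g})) = q + 1"
    using q sum_canonical_char_mult_nonzero[of "0 :: 'g"] by simp
  have sum_cnj: "(\<Sum>\<beta>\<in>-{0}. q * canonical_char (- (\<gamma> / \<beta>)) + 1) = 1" if "\<gamma> \<noteq> 0" for \<gamma> :: 'g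
    using sum_eigenmatrix_V3[OF q(1), of "- \<gamma>"] that by simp
  have neg: "(\<Sum>\<beta>\<in>S. - f \<beta> - 1) = - (\<Sum>\<beta>\<in>S. f \<beta> + 1)" for f :: "'g \<Rightarrow> complex" and S
    by (simp add: sum_negf[symmetric])
  have nonzero: "\<gamma> \<noteq> 0" if "V3 \<gamma> \<in> eig_labels" for \<gamma> :: 'g
    using that by (auto simp: eig_labels_def)
  note facts = sum_rel_labels q card cnj_canonical_char sum_cnj sum_eigenmatrix_V3[OF q(1)]
    sum_eigenmatrix_V3_V3[OF q(1)] nonzero sum_distrib_left[symmetric] sum_distrib_right[symmetric]
    neg
  show ?thesis
    by (insert jk, (cases j; cases k))
      (simp_all add: facts, simp_all add: algebra_simps power2_eq_square)
qed

text \<open>Parameters of the characters spanning each eigenspace. Through \<open>perp_line\<close>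
  the finite and the vertical family in the definition of \<open>V3\<close> become a single
  one.\<close>

fun eig_gens :: "('g::finite_field \<Rightarrow> 'f::finite_field ext) \<Rightarrow> 'g eig_label \<Rightarrow> ('g \<times> 'f \<times> 'f) set" where
  "eig_gens \<phi> V0 = {(0, 0, 0)}"
| "eig_gens \<phi> V1 = {(b, 0, 0) | b. b \<noteq> 0}"
| "eig_gens \<phi> V2 = {(0, \<alpha>1, \<alpha>2) | \<alpha>1 \<alpha>2. (\<alpha>1, \<alpha>2) \<noteq> (0, 0)}"
| "eig_gens \<phi> (V3 \<gamma>) = {(b, \<alpha>1, \<alpha>2) | b \<alpha>1 \<alpha>2.
     b \<noteq> 0 \<and> (\<alpha>1, \<alpha>2) \<noteq> (0, 0) \<and> b * inv \<phi> (perp_line \<alpha>1 \<alpha>2) = \<gamma>}"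

lemma eigspace_eq_span:
  "eigspace \<phi> j = vec.span ((\<lambda>(b, \<alpha>1, \<alpha>2). char_vec b \<alpha>1 \<alpha>2) ` eig_gens \<phi> j)"
proof (cases j)
  case V2
  show ?thesis
    unfolding V2 eigspace.simps
    by (rule arg_cong[of _ _ vec.span]) (auto simp: image_iff; blast)
next
  case (V3 \<gamma>)
  show ?thesis
    unfolding V3 eigspace.simps
    by (rule arg_cong[of _ _ vec.span]) (auto simp: perp_line_def image_iff; metis)
qed (auto intro!: arg_cong[of _ _ vec.span] simp: image_iff)

lemma finite_eig_labels: "finite (eig_labels :: 'g::finite_field eig_label set)"
proof -
  have "(eig_labels :: 'g eig_label set) = {V0, V1, V2} \<union> V3 ` (- {0})"
    by (auto simp: eig_labels_def)
  thus ?thesis by (rule ssubst) simp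
qed

context line_labelling
begin

lemma eig_gens_cover: "\<exists>j\<in>eig_labels. (b, \<alpha>1, \<alpha>2) \<in> eig_gens \<phi> j"
proof -
  consider "b = 0" "(\<alpha>1, \<alpha>2) = (0, 0)" | "b \<noteq> 0" "(\<alpha>1, \<alpha>2) = (0, 0)"
    | "b = 0" "(\<alpha>1, \<alpha>2) \<noteq> (0, 0)" | "b \<noteq> 0" "(\<alpha>1, \<alpha>2) \<noteq> (0, 0)" by blast
  thus ?thesis
  proof cases
    case 4
    moreover have "inv \<phi> (perp_line \<alpha>1 \<alpha>2) \<noteq> 0"
      by (rule inv_nonzero) (simp add: perp_line_def)
    ultimately show ?thesis
      by (intro bexI[of _ "V3 (b * inv \<phi> (perp_line \<alpha>1 \<alpha>2))"]) (auto simp: eig_labels_def)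
  qed (auto simp: eig_labels_def)
qed

lemma eig_gens_nonempty:
  assumes "j \<in> eig_labels"
  shows "eig_gens \<phi> j \<noteq> {}"
proof (cases j)
  case (V3 \<gamma>)
  hence "\<phi> \<gamma> \<noteq> SymX" using assms eq_SymX_iff by (auto simp: eig_labels_def)
  \<comment> \<open>With first parameter 1, membership in \<open>V3 \<gamma>\<close> means that the
    perpendicular line is \<open>\<phi> \<gamma>\<close>, and every line is perpendicular to some
    nonzero pair.\<close>
  hence "\<exists>\<alpha>1 \<alpha>2. (\<alpha>1, \<alpha>2) \<noteq> (0, 0) \<and> perp_line \<alpha>1 \<alpha>2 = \<phi> \<gamma>"
  proof (cases "\<phi> \<gamma>")
    case (Elem c)
    thus ?thesis by (intro exI[of _ "- c"] exI[of _ 1]) (simp add: perp_line_def)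
  next
    case SymY
    thus ?thesis by (intro exI[of _ 1] exI[of _ 0]) (simp add: perp_line_def)
  qed auto
  then obtain \<alpha>1 \<alpha>2 where \<alpha>: "(\<alpha>1, \<alpha>2) \<noteq> (0, 0)" "perp_line \<alpha>1 \<alpha>2 = \<phi> \<gamma>" by blast
  moreover have "inv \<phi> (\<phi> \<gamma>) = \<gamma>" using eq_iff_inv by metis
  ultimately have "(1, \<alpha>1, \<alpha>2) \<in> eig_gens \<phi> j" by (auto simp: V3)
  thus ?thesis by blast
qed (auto intro: exI[of _ 1])

text \<open>The eigenvalue depends on the parameters only through the label \<open>j\<close>: on
  \<open>V3 \<gamma>\<close> the argument
  \<open>b * inv \<phi> (perp_line \<alpha>1 \<alpha>2) / \<beta>\<close> is
  \<open>\<gamma> / \<beta>\<close>.\<close>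

lemma char_eigval_eq_eigenmatrix:
  assumes q: "CARD('f) = q" "CARD('g) = q + 2" and r: "r \<in> rel_labels"
    and gen: "(b, \<alpha>1, \<alpha>2) \<in> eig_gens \<phi> j"
  shows "char_eigval b \<alpha>1 \<alpha>2 r = eigenmatrix (of_nat q) j r"
proof -
  have \<beta>: "\<beta> \<noteq> 0" if "r = R3 \<beta>" for \<beta> using that r by (auto simp: rel_labels_def)
  show ?thesis
    using gen
    by (cases j; cases r)
      (auto simp: q char_eigval_R0 char_eigval_R1 char_eigval_R2 char_eigval_R3[OF \<beta>]
        algebra_simps power2_eq_square)
qed

text \<open>Row orthogonality supplies the inverse of \<open>P\<close>: the conjugate transpose,
  weighted by multiplicities and inverse valencies and divided by the common right-hand
  side.\<close>

lemma eigen_system: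
  assumes q: "CARD('f) = q" "CARD('g) = q + 2"
  defines "c \<equiv> of_nat q :: complex"
  shows "eigen_system rel_labels (adjacency \<phi>) eig_labels (eigspace \<phi>) (eigenmatrix c)
    (\<lambda>i k. eig_multiplicity c k * inverse_valency c i * cnj (eigenmatrix c k i) /
      ((c + 2) * c\<^sup>2 * (c\<^sup>2 - 1)))"
proof
  show "finite (rel_labels :: 'g rel_label set)" "finite (eig_labels :: 'g eig_label set)"
    by (rule finite_rel_labels finite_eig_labels)+
  show "vec.subspace (eigspace \<phi> j)" for j by (simp add: eigspace_eq_span)
  show "eigspace \<phi> j \<noteq> {0}" if j: "j \<in> eig_labels" for j
  proof -
    obtain b \<alpha>1 \<alpha>2 where "(b, \<alpha>1, \<alpha>2) \<in> eig_gens \<phi> j" using eig_gens_nonempty[OF j] by auto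
    hence "char_vec b \<alpha>1 \<alpha>2 \<in> eigspace \<phi> j"
      unfolding eigspace_eq_span by (intro vec.span_base) force
    thus ?thesis using char_vec_nonzero by blast
  qed
  show "vec.span (\<Union>j\<in>eig_labels. eigspace \<phi> j) = UNIV"
  proof -
    have "char_vec b \<alpha>1 \<alpha>2 \<in> (\<Union>j\<in>eig_labels. eigspace \<phi> j)" for b \<alpha>1 \<alpha>2
    proof -
      obtain j where "j \<in> eig_labels" "(b, \<alpha>1, \<alpha>2) \<in> eig_gens \<phi> j" using eig_gens_cover by blast
      moreover from this(2) have "char_vec b \<alpha>1 \<alpha>2 \<in> eigspace \<phi> j"
        unfolding eigspace_eq_span by (intro vec.span_base) force
      ultimately show ?thesis by blast
    qed
    hence "{char_vec b \<alpha>1 \<alpha>2 | b \<alpha>1 \<alpha>2. True} \<subseteq> (\<Union>j\<in>eig_labels. eigspace \<phi> j)" by blast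
    from vec.span_mono[OF this] show ?thesis unfolding span_char_vec by blast
  qed
  show "adjacency \<phi> i *v v = eigenmatrix c j i *s v"
    if "j \<in> eig_labels" and i: "i \<in> rel_labels" and v: "v \<in> eigspace \<phi> j" for j i v
  proof -
    \<comment> \<open>The eigenvalue equation is linear in \<open>v\<close>, so it suffices to
      verify it on the spanning characters.\<close>
    have "vec.subspace {v. adjacency \<phi> i *v v = eigenmatrix c j i *s v}"
      by (auto simp: vec.subspace_def matrix_vector_right_distrib vec.scale
          vec.scale_right_distrib mult.commute)
    moreover have "(\<lambda>(b, \<alpha>1, \<alpha>2). char_vec b \<alpha>1 \<alpha>2) ` eig_gens \<phi> j \<subseteq>
      {v. adjacency \<phi> i *v v = eigenmatrix c j i *s v}"
      using adjacency_char_vec[OF i] char_eigval_eq_eigenmatrix[OF q i] by (auto simp: c_def)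
    ultimately show ?thesis
      using v vec.span_minimal unfolding eigspace_eq_span by blast
  qed
  \<comment> \<open>The factor \<open>c^2 - 1\<close> is nonzero because a field has at least two
    elements, so \<open>q > 1\<close>.\<close>
  have nz: "(c + 2) * c\<^sup>2 * (c\<^sup>2 - 1) \<noteq> 0"
  proof -
    have "q > 1"
      using q(1) card_mono[of UNIV "{0, 1 :: 'f}"] by simp
    hence "q\<^sup>2 > 1" by (rule one_less_power) simp
    hence "(q + 2) * q\<^sup>2 * (q\<^sup>2 - 1) \<noteq> 0" and "q\<^sup>2 \<ge> 1"
      using \<open>q > 1\<close> by auto
    moreover from this(2) have "(c + 2) * c\<^sup>2 * (c\<^sup>2 - 1) = of_nat ((q + 2) * q\<^sup>2 * (q\<^sup>2 - 1))"
      by (simp add: c_def of_nat_diff distrib_right)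
    ultimately show ?thesis by (simp only: of_nat_eq_0_iff not_False_eq_True)
  qed
  show "(\<Sum>i\<in>rel_labels. eigenmatrix c j i *
      (eig_multiplicity c k * inverse_valency c i * cnj (eigenmatrix c k i) / ((c + 2) * c\<^sup>2 * (c\<^sup>2 - 1)))) =
    (if j = k then 1 else 0)" if jk: "j \<in> eig_labels" "k \<in> eig_labels" for j k :: "'g eig_label"
  proof -
    have "(\<Sum>i\<in>rel_labels. eigenmatrix c j i *
        (eig_multiplicity c k * inverse_valency c i * cnj (eigenmatrix c k i) / ((c + 2) * c\<^sup>2 * (c\<^sup>2 - 1)))) =
      eig_multiplicity c k * (\<Sum>i\<in>rel_labels. inverse_valency c i * eigenmatrix c j i *
        cnj (eigenmatrix c k i)) / ((c + 2) * c\<^sup>2 * (c\<^sup>2 - 1))"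
      by (simp add: sum_distrib_left sum_divide_distrib mult_ac)
    also have "\<dots> = (if j = k then (c + 2) * c\<^sup>2 * (c\<^sup>2 - 1) else 0) / ((c + 2) * c\<^sup>2 * (c\<^sup>2 - 1))"
      by (subst eigenmatrix_orthogonality) (use jk q in \<open>auto simp: c_def\<close>)
    also have "\<dots> = (if j = k then 1 else 0)"
      using divide_self[OF nz] by (cases "j = k") simp_all
    finally show ?thesis .
  qed
qed

end

theorem theorem3p5:
  fixes q :: nat and \<phi> :: "'g::finite_field \<Rightarrow> 'f::finite_field ext"
  assumes "CARD('f) = q" and "CARD('g) = q + 2"
    and "bij \<phi>" and "\<phi> 0 = SymX"
  shows
    "commutative_association_scheme R0 rel_labels (adjacency \<phi>) \<and>
     bij_betw (eigspace \<phi>) eig_labels {U. maximal_common_eigenspace rel_labels (adjacency \<phi>) U} \<and>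
     (\<exists>P. first_eigenmatrix rel_labels (adjacency \<phi>) eig_labels (eigspace \<phi>) P \<and>
       (\<forall>\<beta> \<gamma>. \<beta> \<noteq> 0 \<and> \<gamma> \<noteq> 0 \<longrightarrow>
         P V0 R0 = 1 \<and> P V0 R1 = of_nat q + 1 \<and>
         P V0 R2 = (of_nat q)\<^sup>2 - 1 \<and> P V0 (R3 \<beta>) = (of_nat q)\<^sup>2 - 1 \<and>
         P V1 R0 = 1 \<and> P V1 R1 = - 1 \<and>
         P V1 R2 = (of_nat q)\<^sup>2 - 1 \<and> P V1 (R3 \<beta>) = - of_nat q + 1 \<and>
         P V2 R0 = 1 \<and> P V2 R1 = of_nat q + 1 \<and>
         P V2 R2 = - 1 \<and> P V2 (R3 \<beta>) = - 1 \<and>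
         P (V3 \<gamma>) R0 = 1 \<and> P (V3 \<gamma>) R1 = - 1 \<and>
         P (V3 \<gamma>) R2 = - 1 \<and> P (V3 \<gamma>) (R3 \<beta>) = of_nat q * canonical_char (\<gamma> / \<beta>) + 1))"
proof -
  interpret line_labelling \<phi>
    using assms by unfold_locales
  interpret eigen_system rel_labels "adjacency \<phi>" eig_labels "eigspace \<phi>" "eigenmatrix (of_nat q)"
    "\<lambda>i k. eig_multiplicity (of_nat q) k * inverse_valency (of_nat q) i *
      cnj (eigenmatrix (of_nat q) k i) / ((of_nat q + 2) * (of_nat q)\<^sup>2 * ((of_nat q)\<^sup>2 - 1))"
    using eigen_system[OF assms(1,2)] by simp
  have "commutative_association_scheme R0 rel_labels (adjacency \<phi>)"
  proof (rule commutative_association_scheme)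
    show "R0 \<in> rel_labels" "adjacency \<phi> R0 = mat 1" by (simp_all add: rel_labels_def)
    show "adjacency \<phi> i $ x $ y \<in> {0, 1}" if "i \<in> rel_labels" for i x y
      by (simp add: adjacency_nth that)
  qed (simp_all add: adjacency_nonzero sum_adjacency transpose_adjacency)
  thus ?thesis
    using bij_betw_maximal_common_eigenspaces first_eigenmatrix
    by (intro conjI exI[of _ "eigenmatrix (of_nat q)"]) simp_all
qed

end
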